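(* Let $f$ be a $*$-identity of $M_{1,2}(F)$ of degree at most $3$. Then $f$ belongs to the $T_2^*$-ideal of the free $*$-superalgebra generated by the set $\mathcal{I}$ consisting of the $*$-polynomials $[y_1^+,y_2^+]$, $[y_1^+,y_1^-]$, $y_1^-z_1^+y_2^-$, $y_1^-z_1^-y_2^-$, $z_1^+z_2^+z_3^++z_2^+z_3^+z_1^++z_3^+z_1^+z_2^+$, $z_1^-z_2^-z_3^-+z_2^-z_3^-z_1^-+z_3^-z_1^-z_2^-$, $z_1^+y_1^-z_2^+-z_2^+y_1^-z_1^+$, $z_1^-y_1^-z_2^--z_2^-y_1^-z_1^-$, $z_1^+z_2^+z_1^--z_2^+z_1^-z_1^++z_1^-z_1^+z_2^+$, $z_1^-z_2^-z_1^+-z_2^-z_1^+z_1^-+z_1^+z_1^-z_2^-$, $z_1^+y_1^-z_1^-+z_1^-y_1^-z_1^+$.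
   Context: $F$ is a field of characteristic zero. $M_{1,2}(F)$ is the algebra of $3\times 3$ matrices over $F$ with $\mathbb{Z}_2$-grading whose even part is spanned by $e_{11},e_{22},e_{23},e_{32},e_{33}$ and odd part by $e_{12},e_{13},e_{21},e_{31}$, with the orthosymplectic superinvolution $*$ sending the matrix with rows $(a,b,c),(d,e,f),(g,h,i)$ to the matrix with rows $(a,-g,d),(c,i,-f),(-b,-h,e)$ (a superinvolution is a grading-preserving linear map with $(a^* )^*=a$ and $(ab)^*=(-1)^{|a||b|}b^*a^*$). The free $*$-superalgebra is the free associative algebra on variables $y_i^+$ (even, symmetric), $y_i^-$ (even, skew), $z_i^+$ (odd, symmetric), $z_i^-$ (odd, skew), $i\ge 1$, with the grading and the superinvolution determined by these labels. A $*$-polynomial is a $*$-identity of $M_{1,2}(F)$ if it vanishes under every substitution of $y_i^+,y_i^-,z_i^+,z_i^-$ by elements of the even symmetric, even skew, odd symmetric, odd skew parts of $M_{1,2}(F)$, respectively. A $T_2^*$-ideal is an ideal of the free $*$-superalgebra invariant under all grading-preserving endomorphisms commuting with the superinvolution. $[a,b]=ab-ba$. *)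

theory Defs
  imports "HOL-Analysis.Analysis" "HOL-Library.Poly_Mapping"
begin

text \<open>Kinds of variables: YP = y^+ (even, symmetric), YM = y^- (even, skew),
  ZP = z^+ (odd, symmetric), ZM = z^- (odd, skew).\<close>
datatype vkind = YP | YM | ZP | ZM

type_synonym var = "vkind \<times> nat"

definition kodd :: "vkind \<Rightarrow> bool" where
  "kodd k \<longleftrightarrow> k = ZP \<or> k = ZM"

definition ksign :: "vkind \<Rightarrow> int" where
  "ksign k = (if k = YP \<or> k = ZP then 1 else -1)"

text \<open>Words (monomials) in the variables; the free monoid, written additively
  so that the monoid algebra of Poly_Mapping is the free associative algebra.\<close>
datatype word = W "var list"

fun wlist :: "word \<Rightarrow> var list" where
  "wlist (W xs) = xs"

instantiation word :: monoid_add
begin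
fun plus_word :: "word \<Rightarrow> word \<Rightarrow> word" where
  "plus_word (W a) (W b) = W (a @ b)"
definition zero_word :: word where
  "zero_word = W []"
instance
proof
  fix a b c :: word
  show "a + b + c = a + (b + c)" by (cases a; cases b; cases c) simp
  show "0 + a = a" by (cases a) (simp add: zero_word_def)
  show "a + 0 = a" by (cases a) (simp add: zero_word_def)
qed
end

text \<open>The free associative algebra F<X> over F with basis the words
  (this type is a ring_1 via the Poly_Mapping monoid-algebra instance).\<close>
type_synonym 'a fpoly = "word \<Rightarrow>\<^sub>0 'a"

definition fvar :: "vkind \<Rightarrow> nat \<Rightarrow> 'a::ring_1 fpoly" where
  "fvar k i = Poly_Mapping.single (W [(k, i)]) 1"

abbreviation "yp i \<equiv> fvar YP i"
abbreviation "ym i \<equiv> fvar YM i"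
abbreviation "zp i \<equiv> fvar ZP i"
abbreviation "zm i \<equiv> fvar ZM i"

definition fsmult :: "'a::ring_1 \<Rightarrow> 'a fpoly \<Rightarrow> 'a fpoly" where
  "fsmult c p = Poly_Mapping.single 0 c * p"

definition nodd :: "word \<Rightarrow> nat" where
  "nodd w = length (filter (\<lambda>x. kodd (fst x)) (wlist w))"

definition wdeg :: "word \<Rightarrow> nat" where
  "wdeg w = length (wlist w)"

text \<open>Superinvolution on the free algebra: for a monomial x_1...x_n,
  (x_1...x_n)^* = (-1)^(k choose 2) * (prod of signs) * x_n ... x_1,
  k the number of odd letters (forced by (ab)^* = (-1)^{|a||b|} b^* a^*).\<close>
definition wsign :: "word \<Rightarrow> int" where
  "wsign w = (-1) ^ (nodd w choose 2) * prod_list (map (\<lambda>x. ksign (fst x)) (wlist w))"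

definition wrev :: "word \<Rightarrow> word" where
  "wrev w = W (rev (wlist w))"

definition fstar :: "'a::ring_1 fpoly \<Rightarrow> 'a fpoly" where
  "fstar p = (\<Sum>w\<in>Poly_Mapping.keys p. Poly_Mapping.single (wrev w) (of_int (wsign w) * Poly_Mapping.lookup p w))"

definition fpoly_even :: "'a::ring_1 fpoly \<Rightarrow> bool" where
  "fpoly_even p \<longleftrightarrow> (\<forall>w\<in>Poly_Mapping.keys p. even (nodd w))"

definition fpoly_odd :: "'a::ring_1 fpoly \<Rightarrow> bool" where
  "fpoly_odd p \<longleftrightarrow> (\<forall>w\<in>Poly_Mapping.keys p. odd (nodd w))"

definition star_graded_endo :: "('a::ring_1 fpoly \<Rightarrow> 'a fpoly) \<Rightarrow> bool" where
  "star_graded_endo \<phi> \<longleftrightarrow>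
     (\<forall>p q. \<phi> (p + q) = \<phi> p + \<phi> q) \<and>
     (\<forall>c p. \<phi> (fsmult c p) = fsmult c (\<phi> p)) \<and>
     (\<forall>p q. \<phi> (p * q) = \<phi> p * \<phi> q) \<and>
     (\<forall>p. fpoly_even p \<longrightarrow> fpoly_even (\<phi> p)) \<and>
     (\<forall>p. fpoly_odd p \<longrightarrow> fpoly_odd (\<phi> p)) \<and>
     (\<forall>p. \<phi> (fstar p) = fstar (\<phi> p))"

definition is_T2star_ideal :: "'a::ring_1 fpoly set \<Rightarrow> bool" where
  "is_T2star_ideal J \<longleftrightarrow>
     0 \<in> J \<and>
     (\<forall>p\<in>J. \<forall>q\<in>J. p + q \<in> J) \<and>
     (\<forall>c. \<forall>p\<in>J. fsmult c p \<in> J) \<and>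
     (\<forall>a. \<forall>p\<in>J. a * p \<in> J \<and> p * a \<in> J) \<and>
     (\<forall>\<phi>. star_graded_endo \<phi> \<longrightarrow> (\<forall>p\<in>J. \<phi> p \<in> J))"

definition T2star_ideal_gen :: "'a::ring_1 fpoly set \<Rightarrow> 'a fpoly set" where
  "T2star_ideal_gen S = \<Inter>{J. is_T2star_ideal J \<and> S \<subseteq> J}"

text \<open>3x3 matrices as a^3^3; indices 1,2,3 of the numeral type 3
  (where the literal 3 denotes the third index).\<close>

definition M12_even :: "'a::field ^3^3 \<Rightarrow> bool" where
  "M12_even A \<longleftrightarrow> A$1$2 = 0 \<and> A$1$3 = 0 \<and> A$2$1 = 0 \<and> A$3$1 = 0"

definition M12_odd :: "'a::field ^3^3 \<Rightarrow> bool" where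
  "M12_odd A \<longleftrightarrow> A$1$1 = 0 \<and> A$2$2 = 0 \<and> A$2$3 = 0 \<and> A$3$2 = 0 \<and> A$3$3 = 0"

definition M12_star :: "'a::field ^3^3 \<Rightarrow> 'a^3^3" where
  "M12_star A = (\<chi> i j.
     if i = 1 \<and> j = 1 then A$1$1 else
     if i = 1 \<and> j = 2 then - A$3$1 else
     if i = 1 \<and> j = 3 then A$2$1 else
     if i = 2 \<and> j = 1 then A$1$3 else
     if i = 2 \<and> j = 2 then A$3$3 else
     if i = 2 \<and> j = 3 then - A$2$3 else
     if i = 3 \<and> j = 1 then - A$1$2 else
     if i = 3 \<and> j = 2 then - A$3$2 else A$2$2)"

definition M12_admissible :: "(var \<Rightarrow> 'a::field ^3^3) \<Rightarrow> bool" where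
  "M12_admissible \<sigma> \<longleftrightarrow> (\<forall>i.
     (M12_even (\<sigma> (YP, i)) \<and> M12_star (\<sigma> (YP, i)) = \<sigma> (YP, i)) \<and>
     (M12_even (\<sigma> (YM, i)) \<and> M12_star (\<sigma> (YM, i)) = - \<sigma> (YM, i)) \<and>
     (M12_odd (\<sigma> (ZP, i)) \<and> M12_star (\<sigma> (ZP, i)) = \<sigma> (ZP, i)) \<and>
     (M12_odd (\<sigma> (ZM, i)) \<and> M12_star (\<sigma> (ZM, i)) = - \<sigma> (ZM, i)))"

definition eval_word :: "(var \<Rightarrow> 'a::field ^3^3) \<Rightarrow> word \<Rightarrow> 'a^3^3" where
  "eval_word \<sigma> w = foldr (\<lambda>x A. \<sigma> x ** A) (wlist w) (mat 1)"

definition eval_fpoly :: "(var \<Rightarrow> 'a::field ^3^3) \<Rightarrow> 'a fpoly \<Rightarrow> 'a^3^3" where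
  "eval_fpoly \<sigma> p = (\<Sum>w\<in>Poly_Mapping.keys p. (\<chi> i j. Poly_Mapping.lookup p w * (eval_word \<sigma> w)$i$j))"

definition is_M12_star_identity :: "'a::field fpoly \<Rightarrow> bool" where
  "is_M12_star_identity f \<longleftrightarrow> (\<forall>\<sigma>. M12_admissible \<sigma> \<longrightarrow> eval_fpoly \<sigma> f = 0)"

definition fdeg_le :: "'a::ring_1 fpoly \<Rightarrow> nat \<Rightarrow> bool" where
  "fdeg_le f d \<longleftrightarrow> (\<forall>w\<in>Poly_Mapping.keys f. wdeg w \<le> d)"

definition gens_I :: "'a::ring_1 fpoly set" where
  "gens_I = {
     yp 1 * yp 2 - yp 2 * yp 1,
     yp 1 * ym 1 - ym 1 * yp 1,
     ym 1 * zp 1 * ym 2,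
     ym 1 * zm 1 * ym 2,
     zp 1 * zp 2 * zp 3 + zp 2 * zp 3 * zp 1 + zp 3 * zp 1 * zp 2,
     zm 1 * zm 2 * zm 3 + zm 2 * zm 3 * zm 1 + zm 3 * zm 1 * zm 2,
     zp 1 * ym 1 * zp 2 - zp 2 * ym 1 * zp 1,
     zm 1 * ym 1 * zm 2 - zm 2 * ym 1 * zm 1,
     zp 1 * zp 2 * zm 1 - zp 2 * zm 1 * zp 1 + zm 1 * zp 1 * zp 2,
     zm 1 * zm 2 * zp 1 - zm 2 * zp 1 * zm 1 + zp 1 * zm 1 * zm 2,
     zp 1 * ym 1 * zm 1 + zm 1 * ym 1 * zp 1}"

end

theory Submission
  imports Defs
begin

text \<open>
  Scaling a substitution by \<open>t = 0, 1, -1, 2\<close> shows that every homogeneous component of an identity of degree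
  at most 3 is an identity, and polarization then yields, for all letters \<open>x\<^sub>1, x\<^sub>2, x\<^sub>3\<close> (possibly equal)
  and all matrices \<open>A\<^sub>1, A\<^sub>2, A\<^sub>3\<close> of the matching kinds, \<open>\<Sum>\<^sub>\<pi> c(x\<^sub>\<pi>) A\<^sub>\<pi>\<^sub>1 A\<^sub>\<pi>\<^sub>2 A\<^sub>\<pi>\<^sub>3 = 0\<close>, where \<open>c\<close> denotes the
  coefficients of the cubic component. Summing the polynomials \<open>\<Sum>\<^sub>\<pi> c(x\<^sub>\<pi>) x\<^sub>\<pi>\<^sub>1 x\<^sub>\<pi>\<^sub>2 x\<^sub>\<pi>\<^sub>3\<close> over all triples of
  letters gives 6 times the cubic component, so it suffices to treat multilinear polynomials of degree 3,
  one multiset of three kinds at a time. For each of them a few matrix units determine the linear relations between the six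
  coefficients, and these are the relations that follow from the generators. The only generators that need
  substitutions of degree 2 are the two commutators, which are applied to
  \<open>y\<^sub>1\<^sup>-y\<^sub>2\<^sup>- + y\<^sub>2\<^sup>-y\<^sub>1\<^sup>-\<close> and to \<open>z\<^sub>1z\<^sub>2 \<plusminus> z\<^sub>2z\<^sub>1\<close>. Since 1 is even and symmetric, components of lower degree are
  multilinear polynomials of degree 3 with some arguments equal to 1.
\<close>

section \<open>Substitutions in the free algebra with superinvolution\<close>

lemma sum_single_keys:
  fixes p :: "'b \<Rightarrow>\<^sub>0 'a::comm_monoid_add"
  shows "(\<Sum>w\<in>Poly_Mapping.keys p. Poly_Mapping.single w (Poly_Mapping.lookup p w)) = p"
proof (rule poly_mapping_eqI)
  fix k
  have "Poly_Mapping.lookup (\<Sum>w\<in>Poly_Mapping.keys p. Poly_Mapping.single w (Poly_Mapping.lookup p w)) k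
     = (\<Sum>w\<in>Poly_Mapping.keys p. if w = k then Poly_Mapping.lookup p w else 0)"
    by (simp add: lookup_sum lookup_single when_def)
  also have "\<dots> = Poly_Mapping.lookup p k"
    by (simp add: sum.delta in_keys_iff)
  finally show "Poly_Mapping.lookup (\<Sum>w\<in>Poly_Mapping.keys p.
      Poly_Mapping.single w (Poly_Mapping.lookup p w)) k = Poly_Mapping.lookup p k" .
qed

text \<open>The sum of \<open>sum_single_keys\<close> is built up one key at a time. The predicate
  \<open>Q\<close> hands a property of the words, later their parity, to the case of a single
  term.\<close>

lemma fpoly_keys_induct [consumes 1, case_names zero single add]:
  fixes p :: "'b \<Rightarrow>\<^sub>0 'a::comm_monoid_add"
  assumes "\<forall>w\<in>Poly_Mapping.keys p. Q w"
    and "P 0"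
    and "\<And>w c. Q w \<Longrightarrow> P (Poly_Mapping.single w c)"
    and "\<And>p q. P p \<Longrightarrow> P q \<Longrightarrow> P (p + q)"
  shows "P p"
proof -
  have "P (\<Sum>w\<in>A. Poly_Mapping.single w (Poly_Mapping.lookup p w))"
    if "finite A" "A \<subseteq> Poly_Mapping.keys p" for A
    using that by (induction A rule: finite_induct) (auto intro!: assms(2-4) simp: assms(1))
  from this[OF finite_keys order_refl] show ?thesis
    by (simp add: sum_single_keys)
qed

lemma fpoly_induct [case_names zero single add]:
  fixes p :: "'b \<Rightarrow>\<^sub>0 'a::comm_monoid_add"
  assumes "P 0"
    and "\<And>w c. P (Poly_Mapping.single w c)"
    and "\<And>p q. P p \<Longrightarrow> P q \<Longrightarrow> P (p + q)"
  shows "P p"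
  using fpoly_keys_induct[of p "\<lambda>_. True" P] assms by blast

section \<open>Scalar multiplication in the free algebra\<close>

lemma fsmult_single [simp]: "fsmult c (Poly_Mapping.single w d) = Poly_Mapping.single w (c * d)"
  by (simp add: fsmult_def mult_single)

lemma fsmult_add_right: "fsmult c (p + q) = fsmult c p + fsmult c q"
  by (simp add: fsmult_def algebra_simps)

lemma fsmult_diff_right: "fsmult c (p - q) = fsmult c p - fsmult c q"
  by (simp add: fsmult_def algebra_simps)

lemma fsmult_minus_right: "fsmult c (- p) = - fsmult c p"
  by (simp add: fsmult_def)

lemma fsmult_add_left: "fsmult (c + d) p = fsmult c p + fsmult d p"
  by (simp add: fsmult_def algebra_simps single_add)

lemma fsmult_minus_left: "fsmult (- c) p = - fsmult c p"
  by (simp add: fsmult_def algebra_simps single_uminus)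

lemma fsmult_diff_left: "fsmult (c - d) p = fsmult c p - fsmult d p"
  by (simp add: fsmult_def algebra_simps single_diff)

lemma fsmult_zero_left [simp]: "fsmult 0 p = 0"
  by (simp add: fsmult_def)

lemma fsmult_zero_right [simp]: "fsmult c 0 = 0"
  by (simp add: fsmult_def)

lemma fsmult_one [simp]: "fsmult 1 p = p"
  by (simp add: fsmult_def)

lemma fsmult_fsmult: "fsmult c (fsmult d p) = fsmult (c * d) p"
  by (simp add: fsmult_def mult_single flip: mult.assoc)

lemma fsmult_mult_left: "fsmult c p * q = fsmult c (p * q)"
  by (simp add: fsmult_def mult.assoc)

lemma single_zero_commute:
  fixes p :: "'a::comm_ring_1 fpoly"
  shows "p * Poly_Mapping.single 0 c = Poly_Mapping.single 0 c * p"
  by (induction p rule: fpoly_induct) (simp_all add: mult_single algebra_simps)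

lemma fsmult_mult_right:
  fixes p :: "'a::comm_ring_1 fpoly"
  shows "p * fsmult c q = fsmult c (p * q)"
  by (simp add: fsmult_def single_zero_commute flip: mult.assoc)

lemmas fsmult_linear = fsmult_add_right fsmult_diff_right fsmult_minus_right
  fsmult_add_left fsmult_diff_left fsmult_minus_left

section \<open>Substitution as an algebra homomorphism\<close>

definition subst_word :: "(var \<Rightarrow> 'a::comm_ring_1 fpoly) \<Rightarrow> word \<Rightarrow> 'a fpoly" where
  "subst_word s w = prod_list (map s (wlist w))"

definition subst_fpoly :: "(var \<Rightarrow> 'a::comm_ring_1 fpoly) \<Rightarrow> 'a fpoly \<Rightarrow> 'a fpoly" where
  "subst_fpoly s p = (\<Sum>w\<in>Poly_Mapping.keys p. fsmult (Poly_Mapping.lookup p w) (subst_word s w))"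

lemma subst_word_add: "subst_word s (v + w) = subst_word s v * subst_word s w"
  by (cases v; cases w) (simp add: subst_word_def)

lemma subst_fpoly_add: "subst_fpoly s (p + q) = subst_fpoly s p + subst_fpoly s q"
  unfolding subst_fpoly_def by (rule setsum_keys_plus_distrib) (simp_all add: fsmult_add_left)

lemma subst_fpoly_zero [simp]: "subst_fpoly s 0 = 0"
  by (simp add: subst_fpoly_def)

lemma subst_fpoly_minus: "subst_fpoly s (- p) = - subst_fpoly s p"
  using subst_fpoly_add[of s p "- p"] by (simp add: eq_neg_iff_add_eq_0 add.commute)

lemma subst_fpoly_diff: "subst_fpoly s (p - q) = subst_fpoly s p - subst_fpoly s q"
  using subst_fpoly_add[of s p "- q"] by (simp add: subst_fpoly_minus)

lemma subst_fpoly_single: "subst_fpoly s (Poly_Mapping.single w c) = fsmult c (subst_word s w)"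
  by (simp add: subst_fpoly_def)

lemma subst_fpoly_fvar: "subst_fpoly s (fvar k i) = s (k, i)"
  by (simp add: fvar_def subst_fpoly_single subst_word_def)

lemma subst_fpoly_fsmult: "subst_fpoly s (fsmult c p) = fsmult c (subst_fpoly s p)"
  by (induction p rule: fpoly_induct)
     (simp_all add: fsmult_add_right subst_fpoly_add subst_fpoly_single fsmult_fsmult)

lemma subst_fpoly_mult: "subst_fpoly s (p * q) = subst_fpoly s p * subst_fpoly s q"
proof (induction p rule: fpoly_induct)
  case (single v c)
  show ?case
    by (induction q rule: fpoly_induct)
       (simp_all add: mult_single subst_fpoly_single subst_fpoly_add subst_word_add algebra_simps
          fsmult_mult_left fsmult_mult_right fsmult_fsmult)
qed (simp_all add: algebra_simps subst_fpoly_add)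

text \<open>A Boolean parity treats even and odd polynomials at once, and the parity of a product
  becomes the exclusive or \<open>a \<noteq> b\<close>. The zero polynomial has both
  parities.\<close>

definition fpoly_parity :: "bool \<Rightarrow> 'a::ring_1 fpoly \<Rightarrow> bool" where
  "fpoly_parity b p \<longleftrightarrow> (\<forall>w\<in>Poly_Mapping.keys p. odd (nodd w) = b)"

lemma fpoly_even_iff: "fpoly_even p \<longleftrightarrow> fpoly_parity False p"
  by (simp add: fpoly_even_def fpoly_parity_def)

lemma fpoly_odd_iff: "fpoly_odd p \<longleftrightarrow> fpoly_parity True p"
  by (simp add: fpoly_odd_def fpoly_parity_def)

lemma nodd_add: "nodd (v + w) = nodd v + nodd w"
  by (cases v; cases w) (simp add: nodd_def)

lemma fpoly_parity_zero [simp]: "fpoly_parity b 0"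
  by (simp add: fpoly_parity_def)

lemma fpoly_parity_one: "fpoly_parity False 1"
  by (simp add: fpoly_parity_def nodd_def zero_word_def flip: single_one)

lemma fpoly_parity_add: "fpoly_parity b p \<Longrightarrow> fpoly_parity b q \<Longrightarrow> fpoly_parity b (p + q)"
  unfolding fpoly_parity_def using keys_add[of p q] by blast

lemma fpoly_parity_minus: "fpoly_parity b p \<Longrightarrow> fpoly_parity b (- p)"
  by (simp add: fpoly_parity_def in_keys_iff)

lemma fpoly_parity_diff: "fpoly_parity b p \<Longrightarrow> fpoly_parity b q \<Longrightarrow> fpoly_parity b (p - q)"
  using fpoly_parity_add[of b p "- q"] by (simp add: fpoly_parity_minus)

lemma fpoly_parity_mult:
  assumes "fpoly_parity a p" "fpoly_parity b q"
  shows "fpoly_parity (a \<noteq> b) (p * q)"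
  using assms keys_mult[of p q] unfolding fpoly_parity_def by (fastforce simp: nodd_add)

lemma fpoly_parity_fsmult: "fpoly_parity b p \<Longrightarrow> fpoly_parity b (fsmult c p)"
  using fpoly_parity_mult[of False "Poly_Mapping.single 0 c" b p]
  by (simp add: fsmult_def fpoly_parity_def nodd_def zero_word_def)

section \<open>The superinvolution on polynomials\<close>

lemma fstar_add: "fstar (p + q) = fstar p + fstar q"
  unfolding fstar_def
  by (rule setsum_keys_plus_distrib) (simp_all add: single_add algebra_simps)

lemma fstar_zero [simp]: "fstar 0 = 0"
  by (simp add: fstar_def)

lemma fstar_minus: "fstar (- p) = - fstar p"
  using fstar_add[of p "- p"] by (simp add: eq_neg_iff_add_eq_0 add.commute)

lemma fstar_diff: "fstar (p - q) = fstar p - fstar q"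
  using fstar_add[of p "- q"] by (simp add: fstar_minus)

lemma fstar_single:
  "fstar (Poly_Mapping.single w c) = Poly_Mapping.single (wrev w) (of_int (wsign w) * c)"
  by (simp add: fstar_def)

lemma fstar_one [simp]: "fstar 1 = 1"
proof -
  have "fstar (Poly_Mapping.single 0 1) = Poly_Mapping.single 0 (1::'a)"
    by (simp only: fstar_single) (simp add: wrev_def wsign_def nodd_def zero_word_def binomial_eq_0)
  then show ?thesis by simp
qed

lemma fstar_fsmult:
  fixes p :: "'a::comm_ring_1 fpoly"
  shows "fstar (fsmult c p) = fsmult c (fstar p)"
  by (induction p rule: fpoly_induct)
     (simp_all add: fsmult_add_right fstar_add fstar_single mult.left_commute)

text \<open>Among \<open>m + n\<close> odd letters, \<open>m * n\<close> pairs have one letter in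
  each block. This cross term is the exponent of the sign in the rule for the superinvolution of a
  product.\<close>

lemma choose_two_add: "(m + n) choose 2 = (m choose 2) + (n choose 2) + m * n" for m n :: nat
proof (induction m)
  case (Suc m)
  have "Suc k choose 2 = (k choose 2) + k" for k
    by (simp add: numeral_2_eq_2)
  with Suc show ?case by simp
qed simp

lemma wsign_add: "wsign (v + w) = (-1) ^ (nodd v * nodd w) * (wsign w * wsign v)"
proof -
  have "prod_list (map (\<lambda>x. ksign (fst x)) (wlist (v + w))) =
    prod_list (map (\<lambda>x. ksign (fst x)) (wlist v)) * prod_list (map (\<lambda>x. ksign (fst x)) (wlist w))"
    by (cases v; cases w) simp
  then show ?thesis
    by (simp add: wsign_def nodd_add choose_two_add power_add)
qed

lemma wrev_add: "wrev (v + w) = wrev w + wrev v"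
  by (cases v; cases w) (simp add: wrev_def)

text \<open>Both sides are additive in \<open>p\<close> and in \<open>q\<close>, so the rule reduces
  to two words, where it is \<open>wsign_add\<close> and \<open>wrev_add\<close>.\<close>

lemma fstar_mult:
  fixes p q :: "'a::comm_ring_1 fpoly"
  assumes "fpoly_parity a p" "fpoly_parity b q"
  shows "fstar (p * q) = (if a \<and> b then - (fstar q * fstar p) else fstar q * fstar p)"
  using assms(1)[unfolded fpoly_parity_def]
proof (induction p rule: fpoly_keys_induct)
  case (single v c)
  show ?case
    using assms(2)[unfolded fpoly_parity_def]
  proof (induction q rule: fpoly_keys_induct)
    case (single w d)
    have "(-1::int) ^ (nodd v * nodd w) = (if a \<and> b then -1 else 1)"
      using single \<open>odd (nodd v) = a\<close> by auto
    then show ?case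
      by (auto simp: mult_single fstar_single wsign_add wrev_add single_uminus mult_ac)
  qed (auto simp: algebra_simps fstar_add)
qed (auto simp: algebra_simps fstar_add)

text \<open>The polynomials that a graded endomorphism commuting with the superinvolution may assign
  to a letter of kind \<open>k\<close>.\<close>

definition fpoly_kind :: "vkind \<Rightarrow> 'a::ring_1 fpoly \<Rightarrow> bool" where
  "fpoly_kind k p \<longleftrightarrow> fpoly_parity (kodd k) p \<and> fstar p = of_int (ksign k) * p"

lemma fpoly_kind_fvar [simp]: "fpoly_kind k (fvar k i)"
  by (cases k)
     (simp_all add: fpoly_kind_def fpoly_parity_def fvar_def nodd_def kodd_def fstar_single wrev_def
        wsign_def ksign_def binomial_eq_0 flip: single_uminus)

context
  fixes s :: "var \<Rightarrow> 'a::comm_ring_1 fpoly"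
  assumes s_kind: "\<And>k i. fpoly_kind k (s (k, i))"
begin

lemma subst_word_parity: "fpoly_parity (odd (nodd (W xs))) (subst_word s (W xs))"
proof (induction xs)
  case Nil
  show ?case by (simp add: subst_word_def nodd_def fpoly_parity_one)
next
  case (Cons x xs)
  have "fpoly_parity (kodd (fst x)) (s x)"
    using s_kind[of "fst x" "snd x"] by (simp add: fpoly_kind_def)
  from fpoly_parity_mult[OF this Cons] show ?case
    by (cases "kodd (fst x)") (simp_all add: subst_word_def nodd_def)
qed

lemma fstar_subst_word:
  "fstar (subst_word s (W xs)) = of_int (wsign (W xs)) * subst_word s (W (rev xs))"
proof (induction xs)
  case Nil
  show ?case
    by (simp add: subst_word_def wsign_def nodd_def binomial_eq_0)
next
  case (Cons x xs)
  have x: "fpoly_parity (kodd (fst x)) (s x)" "fstar (s x) = of_int (ksign (fst x)) * s x"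
    using s_kind[of "fst x" "snd x"] by (simp_all add: fpoly_kind_def)
  have eq: "subst_word s (W (x # xs)) = s x * subst_word s (W xs)"
    "subst_word s (W (rev (x # xs))) = subst_word s (W (rev xs)) * s x"
    by (simp_all add: subst_word_def)
  \<comment> \<open>For a one-letter prefix the exponent \<open>nodd v * nodd w\<close> is odd
    exactly when both the letter and the rest of the word are odd.\<close>
  have sgn: "wsign (W (x # xs)) =
      (if kodd (fst x) \<and> odd (nodd (W xs)) then - 1 else 1) * (wsign (W xs) * ksign (fst x))"
    using wsign_add[of "W [x]" "W xs"]
    by (simp add: wsign_def[of "W [x]"] nodd_def[of "W [x]"] binomial_eq_0)
  \<comment> \<open>Integers are central, so the signs can be collected although polynomials do not
    commute.\<close>
  have comm: "of_int m * p * (of_int n * q) = of_int (m * n) * (p * q)" for m n and p q :: "'a fpoly"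
    by (simp add: mult.assoc) (metis mult.assoc mult_of_int_commute)
  show ?case
    unfolding eq fstar_mult[OF x(1) subst_word_parity] Cons x(2) sgn comm by auto
qed

lemma fstar_subst_fpoly: "subst_fpoly s (fstar p) = fstar (subst_fpoly s p)"
proof (induction p rule: fpoly_induct)
  case (single w c)
  obtain xs where w: "w = W xs" by (cases w)
  have "fsmult (of_int n * c) p = fsmult c (of_int n * p)" for n and p :: "'a fpoly"
    unfolding fsmult_def by (simp add: mult_single mult.commute[of _ c] flip: mult.assoc single_of_int)
  then show ?case
    by (simp add: w fstar_single subst_fpoly_single fstar_fsmult fstar_subst_word wrev_def)
qed (simp_all add: fstar_add subst_fpoly_add)

lemma subst_fpoly_parity:
  assumes "fpoly_parity b p"
  shows "fpoly_parity b (subst_fpoly s p)"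
  using assms unfolding fpoly_parity_def[of b p]
proof (induction p rule: fpoly_keys_induct)
  case (single w c)
  then show ?case
    using subst_word_parity[of "wlist w"] by (cases w) (simp add: subst_fpoly_single fpoly_parity_fsmult)
qed (simp_all add: subst_fpoly_add fpoly_parity_add)

text \<open>This makes T2*-ideals closed under every replacement of letters by polynomials of the
  same kinds.\<close>

lemma star_graded_endo_subst_fpoly: "star_graded_endo (subst_fpoly s)"
  unfolding star_graded_endo_def fpoly_even_iff fpoly_odd_iff
  by (intro conjI allI impI subst_fpoly_add subst_fpoly_fsmult subst_fpoly_mult
        fstar_subst_fpoly subst_fpoly_parity)

end

section \<open>Consequences of the generators\<close>

text \<open>The two skew signs cancel and even factors are reversed without a further sign, so the
  superinvolution exchanges \<open>p * q\<close> and \<open>q * p\<close>.\<close>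

lemma fpoly_kind_skew_anticommutator:
  fixes p q :: "'a::comm_ring_1 fpoly"
  assumes "fpoly_kind YM p" "fpoly_kind YM q"
  shows "fpoly_kind YP (p * q + q * p)"
  using assms fpoly_parity_mult[of False p False q] fpoly_parity_mult[of False q False p]
  by (auto simp: fpoly_kind_def kodd_def ksign_def fstar_add fstar_mult fpoly_parity_add)

text \<open>The signs of equal kinds cancel, but reversing two odd factors costs a sign: the
  superinvolution sends \<open>p * q\<close> to \<open>- (q * p)\<close>.\<close>

lemma fpoly_kind_odd_same:
  fixes p q :: "'a::comm_ring_1 fpoly"
  assumes "fpoly_kind k p" "fpoly_kind k q" "kodd k"
  shows "fpoly_kind YP (p * q - q * p)" "fpoly_kind YM (p * q + q * p)"
proof -
  have par: "fpoly_parity True p" "fpoly_parity True q"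
    using assms by (simp_all add: fpoly_kind_def)
  have *: "fstar q * fstar p = q * p" "fstar p * fstar q = p * q"
    using assms by (auto simp: fpoly_kind_def ksign_def)
  show "fpoly_kind YP (p * q - q * p)" "fpoly_kind YM (p * q + q * p)"
    using fpoly_parity_mult[OF par] fpoly_parity_mult[OF par(2) par(1)]
    by (simp_all add: fpoly_kind_def kodd_def ksign_def fstar_add fstar_diff * fpoly_parity_add
      fpoly_parity_diff fstar_mult[OF par] fstar_mult[OF par(2) par(1)])
qed

text \<open>Here the one skew factor compensates the sign from reversing odd factors, so
  \<open>p * q\<close> goes to \<open>q * p\<close>.\<close>

lemma fpoly_kind_odd_opposite:
  fixes p q :: "'a::comm_ring_1 fpoly"
  assumes "fpoly_kind ZP p" "fpoly_kind ZM q"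
  shows "fpoly_kind YP (p * q + q * p)" "fpoly_kind YM (p * q - q * p)"
proof -
  have par: "fpoly_parity True p" "fpoly_parity True q"
    using assms by (simp_all add: fpoly_kind_def kodd_def)
  have *: "fstar p = p" "fstar q = - q"
    using assms by (auto simp: fpoly_kind_def ksign_def)
  show "fpoly_kind YP (p * q + q * p)" "fpoly_kind YM (p * q - q * p)"
    using fpoly_parity_mult[OF par] fpoly_parity_mult[OF par(2) par(1)]
    by (simp_all add: fpoly_kind_def kodd_def ksign_def fstar_add fstar_diff * fpoly_parity_add
      fpoly_parity_diff fstar_mult[OF par] fstar_mult[OF par(2) par(1)])
qed

text \<open>The general multilinear combination of three factors, with the six orders listed
  lexicographically. The factors are arbitrary polynomials, so that some of them can later be
  1.\<close>

definition lin6 :: "'a::ring_1 \<Rightarrow> 'a \<Rightarrow> 'a \<Rightarrow> 'a \<Rightarrow> 'a \<Rightarrow> 'a \<Rightarrow> 'a fpoly \<Rightarrow> 'a fpoly \<Rightarrow> 'a fpoly \<Rightarrow> 'a fpoly" where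
  "lin6 c1 c2 c3 c4 c5 c6 p q r = fsmult c1 (p * q * r) + fsmult c2 (p * r * q)
     + fsmult c3 (q * p * r) + fsmult c4 (q * r * p) + fsmult c5 (r * p * q) + fsmult c6 (r * q * p)"

text \<open>The generated ideal is an intersection, so it suffices to argue in an arbitrary
  T2*-ideal containing the generators.\<close>

locale M12_T2star_ideal =
  fixes J :: "'a::field_char_0 fpoly set"
  assumes ideal: "is_T2star_ideal J" and gens: "gens_I \<subseteq> J"
begin

lemma zero_mem: "0 \<in> J"
  using ideal by (auto simp: is_T2star_ideal_def)

lemma add_mem: "p \<in> J \<Longrightarrow> q \<in> J \<Longrightarrow> p + q \<in> J"
  using ideal by (auto simp: is_T2star_ideal_def)

lemma smult_mem: "p \<in> J \<Longrightarrow> fsmult c p \<in> J"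
  using ideal by (auto simp: is_T2star_ideal_def)

lemma mult_left_mem: "p \<in> J \<Longrightarrow> a * p \<in> J"
  using ideal by (auto simp: is_T2star_ideal_def)

lemma mult_right_mem: "p \<in> J \<Longrightarrow> p * a \<in> J"
  using ideal by (auto simp: is_T2star_ideal_def)

lemmas mem_intros = zero_mem add_mem smult_mem mult_left_mem mult_right_mem

lemma sum_mem: "(\<And>x. x \<in> A \<Longrightarrow> h x \<in> J) \<Longrightarrow> sum h A \<in> J"
  by (induction A rule: infinite_finite_induct) (auto intro: mem_intros)

lemma subst_mem:
  assumes "p \<in> J" "\<And>k i. fpoly_kind k (s (k, i))"
  shows "subst_fpoly s p \<in> J"
  using ideal star_graded_endo_subst_fpoly[of s] assms by (auto simp: is_T2star_ideal_def)

lemma gen_mem: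
  "yp 1 * yp 2 - yp 2 * yp 1 \<in> J"
  "yp 1 * ym 1 - ym 1 * yp 1 \<in> J"
  "ym 1 * zp 1 * ym 2 \<in> J"
  "ym 1 * zm 1 * ym 2 \<in> J"
  "zp 1 * zp 2 * zp 3 + zp 2 * zp 3 * zp 1 + zp 3 * zp 1 * zp 2 \<in> J"
  "zm 1 * zm 2 * zm 3 + zm 2 * zm 3 * zm 1 + zm 3 * zm 1 * zm 2 \<in> J"
  "zp 1 * ym 1 * zp 2 - zp 2 * ym 1 * zp 1 \<in> J"
  "zm 1 * ym 1 * zm 2 - zm 2 * ym 1 * zm 1 \<in> J"
  "zp 1 * zp 2 * zm 1 - zp 2 * zm 1 * zp 1 + zm 1 * zp 1 * zp 2 \<in> J"
  "zm 1 * zm 2 * zp 1 - zm 2 * zp 1 * zm 1 + zp 1 * zm 1 * zm 2 \<in> J"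
  "zp 1 * ym 1 * zm 1 + zm 1 * ym 1 * zp 1 \<in> J"
  using gens by (simp_all add: gens_I_def)

section \<open>The generators evaluated at polynomials of matching kinds\<close>

lemmas subst_fpoly_simps = subst_fpoly_add subst_fpoly_diff subst_fpoly_mult subst_fpoly_fvar

lemma comm_YP_YP_mem:
  assumes "fpoly_kind YP p" "fpoly_kind YP q"
  shows "p * q - q * p \<in> J"
  \<comment> \<open>\<open>case_prod fvar\<close> fixes every other letter, so the updated
    substitution still respects all kinds.\<close>
  using subst_mem[OF gen_mem(1), of "(case_prod fvar)((YP, 1) := p, (YP, 2) := q)"] assms
  by (simp add: subst_fpoly_simps)

lemma comm_YP_YM_mem:
  assumes "fpoly_kind YP p" "fpoly_kind YM q"
  shows "p * q - q * p \<in> J"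
  using subst_mem[OF gen_mem(2), of "(case_prod fvar)((YP, 1) := p, (YM, 1) := q)"] assms
  by (simp add: subst_fpoly_simps)

lemma skew_odd_skew_mem:
  assumes "fpoly_kind YM p" "fpoly_kind YM q" "fpoly_kind k r" "kodd k"
  shows "p * r * q \<in> J"
  using subst_mem[OF gen_mem(3), of "(case_prod fvar)((YM, 1) := p, (ZP, 1) := r, (YM, 2) := q)"]
    subst_mem[OF gen_mem(4), of "(case_prod fvar)((YM, 1) := p, (ZM, 1) := r, (YM, 2) := q)"] assms
  by (auto simp add: subst_fpoly_simps kodd_def)

lemma odd_cyclic_mem:
  assumes "fpoly_kind k p" "fpoly_kind k q" "fpoly_kind k r" "kodd k"
  shows "p * q * r + q * r * p + r * p * q \<in> J"
  using subst_mem[OF gen_mem(5), of "(case_prod fvar)((ZP, 1) := p, (ZP, 2) := q, (ZP, 3) := r)"]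
    subst_mem[OF gen_mem(6), of "(case_prod fvar)((ZM, 1) := p, (ZM, 2) := q, (ZM, 3) := r)"] assms
  by (auto simp add: subst_fpoly_simps kodd_def)

lemma odd_skew_odd_same_mem:
  assumes "fpoly_kind YM p" "fpoly_kind k q" "fpoly_kind k r" "kodd k"
  shows "q * p * r - r * p * q \<in> J"
  using subst_mem[OF gen_mem(7), of "(case_prod fvar)((YM, 1) := p, (ZP, 1) := q, (ZP, 2) := r)"]
    subst_mem[OF gen_mem(8), of "(case_prod fvar)((YM, 1) := p, (ZM, 1) := q, (ZM, 2) := r)"] assms
  by (auto simp add: subst_fpoly_simps kodd_def)

lemma odd_mixed_mem:
  assumes "fpoly_kind k p" "fpoly_kind k q" "fpoly_kind l r" "kodd k" "kodd l" "k \<noteq> l"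
  shows "p * q * r - q * r * p + r * p * q \<in> J"
  using subst_mem[OF gen_mem(9), of "(case_prod fvar)((ZP, 1) := p, (ZP, 2) := q, (ZM, 1) := r)"]
    subst_mem[OF gen_mem(10), of "(case_prod fvar)((ZM, 1) := p, (ZM, 2) := q, (ZP, 1) := r)"] assms
  by (auto simp add: subst_fpoly_simps kodd_def)

lemma odd_skew_odd_opposite_mem:
  assumes "fpoly_kind YM p" "fpoly_kind ZP q" "fpoly_kind ZM r"
  shows "q * p * r + r * p * q \<in> J"
  using subst_mem[OF gen_mem(11), of "(case_prod fvar)((YM, 1) := p, (ZP, 1) := q, (ZM, 1) := r)"] assms
  by (auto simp add: subst_fpoly_simps)

text \<open>The even element \<open>q * r\<close> is half the sum of \<open>q * r + r * q\<close>
  and \<open>q * r - r * q\<close>. One of these is symmetric and the other skew, and modulo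
  \<open>J\<close> the symmetric \<open>p\<close> commutes with both.\<close>

lemma comm_YP_odd_odd_mem:
  assumes "fpoly_kind YP p" "fpoly_kind k q" "fpoly_kind l r" "kodd k" "kodd l"
  shows "p * q * r - q * r * p \<in> J"
proof -
  have "p * (q * r + r * q) - (q * r + r * q) * p \<in> J \<and> p * (q * r - r * q) - (q * r - r * q) * p \<in> J"
  proof (cases "k = l")
    case True
    then show ?thesis
      using assms by (metis comm_YP_YP_mem comm_YP_YM_mem fpoly_kind_odd_same)
  next
    case False
    then consider "k = ZP" "l = ZM" | "k = ZM" "l = ZP"
      using assms by (auto simp: kodd_def)
    then show ?thesis
    proof cases
      case 1
      then show ?thesis
        using assms by (metis comm_YP_YP_mem comm_YP_YM_mem fpoly_kind_odd_opposite)
    next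
      case 2
      \<comment> \<open>With the kinds exchanged, the skew element appears as
        \<open>r * q - q * r\<close>; the sign is repaired below.\<close>
      have "fpoly_kind YP (q * r + r * q)" "fpoly_kind YM (r * q - q * r)"
        using fpoly_kind_odd_opposite[of r q] assms 2 by (simp_all add: add.commute)
      then have *: "p * (q * r + r * q) - (q * r + r * q) * p \<in> J"
          "p * (r * q - q * r) - (r * q - q * r) * p \<in> J"
        using assms by (blast intro: comm_YP_YP_mem comm_YP_YM_mem)+
      have "p * (q * r - r * q) - (q * r - r * q) * p
          = (p * (r * q - q * r) - (r * q - q * r) * p) * (- 1)"
        by (simp add: algebra_simps)
      then show ?thesis
        using * by (metis mult_right_mem)
    qed
  qed
  then have "fsmult (1/2) ((p * (q * r + r * q) - (q * r + r * q) * p)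
      + (p * (q * r - r * q) - (q * r - r * q) * p)) \<in> J"
    by (blast intro: mem_intros)
  moreover have "(p * (q * r + r * q) - (q * r + r * q) * p) + (p * (q * r - r * q) - (q * r - r * q) * p)
      = fsmult 2 (p * q * r - q * r * p)"
  proof -
    have "fsmult 2 x = x + x" for x :: "'a fpoly"
      using fsmult_add_left[of 1 1 x] by simp
    then show ?thesis by (simp add: algebra_simps)
  qed
  ultimately show ?thesis
    by (simp add: fsmult_fsmult)
qed

section \<open>Linear conditions on the coefficients that force membership in the ideal\<close>

lemma lin6_mem_commuting:
  assumes "p * q - q * p \<in> J" "p * r - r * p \<in> J" "q * r - r * q \<in> J"
    and "c1 + c2 + c3 + c4 + c5 + c6 = 0"
  shows "lin6 c1 c2 c3 c4 c5 c6 p q r \<in> J"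
proof -
  have c6: "c6 = - (c1 + c2 + c3 + c4 + c5)"
    using assms(4) by algebra
  \<comment> \<open>Adjacent swaps carry every monomial to \<open>r * q * p\<close>, along the
    chains pqr, qpr, qrp, rqp and prq, rpq, rqp. The accumulated coefficients are partial sums, and
    the total left at the end is zero.\<close>
  have "lin6 c1 c2 c3 c4 c5 c6 p q r = fsmult c1 ((p * q - q * p) * r)
     + fsmult (c1 + c3) (q * (p * r - r * p)) + fsmult (c1 + c3 + c4) ((q * r - r * q) * p)
     + fsmult c2 ((p * r - r * p) * q) + fsmult (c2 + c5) (r * (p * q - q * p))"
    by (simp add: lin6_def c6 fsmult_linear algebra_simps)
  then show ?thesis
    using assms by (simp add: mem_intros)
qed

text \<open>Only \<open>p\<close> moves freely, so the monomials split by the order of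
  \<open>q\<close> and \<open>r\<close>, and each class must have coefficient sum zero.\<close>

lemma lin6_mem_first_commuting:
  assumes "p * q - q * p \<in> J" "p * r - r * p \<in> J"
    and "c1 + c3 + c4 = 0" "c2 + c5 + c6 = 0"
  shows "lin6 c1 c2 c3 c4 c5 c6 p q r \<in> J"
proof -
  have c: "c4 = - (c1 + c3)" "c6 = - (c2 + c5)"
    using assms(3,4) by algebra+
  have "lin6 c1 c2 c3 c4 c5 c6 p q r = fsmult c1 ((p * q - q * p) * r)
     + fsmult (c1 + c3) (q * (p * r - r * p))
     + fsmult c2 ((p * r - r * p) * q) + fsmult (c2 + c5) (r * (p * q - q * p))"
    by (simp add: lin6_def c fsmult_linear algebra_simps)
  then show ?thesis
    using assms by (simp add: mem_intros)
qed

text \<open>An anticommutator of two skew elements is symmetric and hence commutes with the third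
  modulo \<open>J\<close>. The three commutators obtained in this way add up to zero, so two of them
  suffice and \<open>c3\<close>, \<open>c4\<close> are the free parameters.\<close>

lemma lin6_mem_skew:
  assumes "fpoly_kind YM p" "fpoly_kind YM q" "fpoly_kind YM r"
    and c: "c1 = c3 - c4" "c2 = - c4" "c5 = - c3" "c6 = c4 - c3"
  shows "lin6 c1 c2 c3 c4 c5 c6 p q r \<in> J"
proof -
  have "lin6 c1 c2 c3 c4 c5 c6 p q r = fsmult c3 ((p * q + q * p) * r - r * (p * q + q * p))
     + fsmult c4 ((q * r + r * q) * p - p * (q * r + r * q))"
    by (simp add: lin6_def c fsmult_linear algebra_simps)
  then show ?thesis
    using assms by (simp add: mem_intros comm_YP_YM_mem fpoly_kind_skew_anticommutator)
qed

lemma lin6_mem_commuting_pair: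
  assumes "p * q - q * p \<in> J"
    and c: "c3 = - c1" "c6 = - c5" "c2 = 0" "c4 = 0"
  shows "lin6 c1 c2 c3 c4 c5 c6 p q r \<in> J"
proof -
  have "lin6 c1 c2 c3 c4 c5 c6 p q r = fsmult c1 ((p * q - q * p) * r) + fsmult c5 (r * (p * q - q * p))"
    by (simp add: lin6_def c fsmult_linear algebra_simps)
  then show ?thesis
    using assms by (simp add: mem_intros)
qed

lemma lin6_mem_skew_skew_odd:
  assumes "fpoly_kind YM p" "fpoly_kind YM q" "fpoly_kind k r" "kodd k"
    and c: "c1 = 0" "c3 = 0" "c5 = 0" "c6 = 0"
  shows "lin6 c1 c2 c3 c4 c5 c6 p q r \<in> J"
  using skew_odd_skew_mem[OF assms(1-4)] skew_odd_skew_mem[OF assms(2,1,3,4)]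
  by (simp add: lin6_def c mem_intros)

lemma lin6_mem_sym_odd_odd:
  assumes "fpoly_kind YP p" "fpoly_kind k q" "fpoly_kind l r" "kodd k" "kodd l"
    and c: "c4 = - c1" "c6 = - c2" "c3 = 0" "c5 = 0"
  shows "lin6 c1 c2 c3 c4 c5 c6 p q r \<in> J"
proof -
  have "lin6 c1 c2 c3 c4 c5 c6 p q r = fsmult c1 (p * q * r - q * r * p) + fsmult c2 (p * r * q - r * q * p)"
    by (simp add: lin6_def c fsmult_linear algebra_simps)
  then show ?thesis
    using comm_YP_odd_odd_mem[OF assms(1-5)] comm_YP_odd_odd_mem[OF assms(1,3,2,5,4)]
    by (simp add: mem_intros)
qed

text \<open>The part with coefficient \<open>c1\<close> is the commutator of \<open>p\<close> with
  the symmetric element \<open>q * r - r * q\<close>; the rest is a generator with the skew letter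
  in the middle.\<close>

lemma lin6_mem_skew_odd_odd_same:
  assumes "fpoly_kind YM p" "fpoly_kind k q" "fpoly_kind k r" "kodd k"
    and c: "c2 = - c1" "c4 = - c1" "c6 = c1" "c5 = - c3"
  shows "lin6 c1 c2 c3 c4 c5 c6 p q r \<in> J"
proof -
  have "lin6 c1 c2 c3 c4 c5 c6 p q r = fsmult (- c1) ((q * r - r * q) * p - p * (q * r - r * q))
      + fsmult c3 (q * p * r - r * p * q)"
    by (simp add: lin6_def c fsmult_linear algebra_simps)
  then show ?thesis
    using assms odd_skew_odd_same_mem[OF assms(1-4)] 
    by (metis comm_YP_YM_mem fpoly_kind_odd_same(1) add_mem smult_mem)
qed

lemma lin6_mem_skew_odd_odd_opposite:
  assumes "fpoly_kind YM p" "fpoly_kind ZP q" "fpoly_kind ZM r"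
    and c: "c2 = c1" "c4 = - c1" "c6 = - c1" "c5 = c3"
  shows "lin6 c1 c2 c3 c4 c5 c6 p q r \<in> J"
proof -
  have "lin6 c1 c2 c3 c4 c5 c6 p q r = fsmult (- c1) ((q * r + r * q) * p - p * (q * r + r * q))
      + fsmult c3 (q * p * r + r * p * q)"
    by (simp add: lin6_def c fsmult_linear algebra_simps)
  then show ?thesis
    using assms odd_skew_odd_opposite_mem[OF assms(1-3)] 
    by (metis comm_YP_YM_mem fpoly_kind_odd_opposite(1) add_mem smult_mem)
qed

text \<open>The two free parameters belong to the two cyclic orders of the factors.\<close>

lemma lin6_mem_odd_same:
  assumes "fpoly_kind k p" "fpoly_kind k q" "fpoly_kind k r" "kodd k"
    and c: "c4 = c1" "c5 = c1" "c3 = c2" "c6 = c2"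
  shows "lin6 c1 c2 c3 c4 c5 c6 p q r \<in> J"
proof -
  have "lin6 c1 c2 c3 c4 c5 c6 p q r = fsmult c1 (p * q * r + q * r * p + r * p * q)
      + fsmult c2 (q * p * r + p * r * q + r * q * p)"
    by (simp add: lin6_def c fsmult_linear algebra_simps)
  then show ?thesis
    using odd_cyclic_mem[OF assms(1-4)] odd_cyclic_mem[OF assms(2,1,3,4)] by (simp add: mem_intros)
qed

lemma lin6_mem_odd_mixed:
  assumes "fpoly_kind k p" "fpoly_kind k q" "fpoly_kind l r" "kodd k" "kodd l" "k \<noteq> l"
    and c: "c4 = - c1" "c5 = c1" "c2 = - c3" "c6 = c3"
  shows "lin6 c1 c2 c3 c4 c5 c6 p q r \<in> J"
proof -
  have "lin6 c1 c2 c3 c4 c5 c6 p q r = fsmult c1 (p * q * r - q * r * p + r * p * q)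
      + fsmult c3 (q * p * r - p * r * q + r * q * p)"
    by (simp add: lin6_def c fsmult_linear algebra_simps)
  then show ?thesis
    using odd_mixed_mem[OF assms(1-6)] odd_mixed_mem[OF assms(2,1,3-6)] by (simp add: mem_intros)
qed

end

section \<open>Coefficients of multilinear identities\<close>

definition mat_kind :: "vkind \<Rightarrow> 'a::field^3^3 \<Rightarrow> bool" where
  "mat_kind k A \<longleftrightarrow> (if kodd k then M12_odd A else M12_even A) \<and>
     M12_star A = (if ksign k = 1 then A else - A)"

lemma M12_admissible_iff: "M12_admissible \<sigma> \<longleftrightarrow> (\<forall>k i. mat_kind k (\<sigma> (k, i)))"
proof -
  have "(\<forall>k i. mat_kind k (\<sigma> (k, i))) \<longleftrightarrow> (\<forall>i. mat_kind YP (\<sigma> (YP, i)) \<and> mat_kind YM (\<sigma> (YM, i)) \<and>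
     mat_kind ZP (\<sigma> (ZP, i)) \<and> mat_kind ZM (\<sigma> (ZM, i)))"
    by (metis vkind.exhaust)
  then show ?thesis
    by (simp add: M12_admissible_def mat_kind_def kodd_def ksign_def)
qed

lemma matrix3_eq_iff:
  "A = B \<longleftrightarrow> A$1$1 = B$1$1 \<and> A$1$2 = B$1$2 \<and> A$1$3 = B$1$3 \<and> A$2$1 = B$2$1 \<and> A$2$2 = B$2$2
     \<and> A$2$3 = B$2$3 \<and> A$3$1 = B$3$1 \<and> A$3$2 = B$3$2 \<and> A$3$3 = B$3$3" for A B :: "'a^3^3"
  by (auto simp: vec_eq_iff forall_3)

lemma mat_kind_zero: "mat_kind k 0"
  by (simp add: mat_kind_def M12_odd_def M12_even_def M12_star_def matrix3_eq_iff)

lemma M12_star_add: "M12_star (A + B) = M12_star A + M12_star B"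
  by (simp add: M12_star_def matrix3_eq_iff)

lemma mat_kind_add: "mat_kind k A \<Longrightarrow> mat_kind k B \<Longrightarrow> mat_kind k (A + B)"
  by (cases "kodd k") (simp_all add: mat_kind_def M12_star_add M12_odd_def M12_even_def)

text \<open>Written entrywise to agree with the summands of \<open>eval_fpoly\<close>.\<close>

definition smat :: "'a::field \<Rightarrow> 'a^3^3 \<Rightarrow> 'a^3^3" where
  "smat c A = (\<chi> i j. c * A$i$j)"

lemma smat_nth [simp]: "smat c A $ i $ j = c * A $ i $ j"
  by (simp add: smat_def)

lemma M12_star_smat: "M12_star (smat c A) = smat c (M12_star A)"
  by (simp add: M12_star_def matrix3_eq_iff)

lemma smat_minus_right: "smat c (- A) = - smat c A"
  by (simp add: matrix3_eq_iff)

lemma mat_kind_smat: "mat_kind k A \<Longrightarrow> mat_kind k (smat c A)"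
  by (cases "kodd k") (simp_all add: mat_kind_def M12_star_smat smat_minus_right M12_odd_def M12_even_def)

definition mat3 :: "'a \<Rightarrow> 'a \<Rightarrow> 'a \<Rightarrow> 'a \<Rightarrow> 'a \<Rightarrow> 'a \<Rightarrow> 'a \<Rightarrow> 'a \<Rightarrow> 'a \<Rightarrow> 'a::zero^3^3" where
  "mat3 a b c d e f g h i = vector [vector [a, b, c], vector [d, e, f], vector [g, h, i]]"

lemma mat3_nth [simp]:
  "mat3 a b c d e f g h i $ 1 = vector [a, b, c]"
  "mat3 a b c d e f g h i $ 2 = vector [d, e, f]"
  "mat3 a b c d e f g h i $ 3 = vector [g, h, i]"
  by (simp_all add: mat3_def)

lemma mat3_mult:
  "mat3 a b c d e f g h i ** mat3 a' b' c' d' e' f' g' h' i' =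
   mat3 (a*a' + b*d' + c*g') (a*b' + b*e' + c*h') (a*c' + b*f' + c*i')
        (d*a' + e*d' + f*g') (d*b' + e*e' + f*h') (d*c' + e*f' + f*i')
        (g*a' + h*d' + i*g') (g*b' + h*e' + i*h') (g*c' + h*f' + i*i')"
  for a :: "'a::field"
  by (simp add: matrix3_eq_iff matrix_matrix_mult_def sum_3)

text \<open>The shapes obtained by solving the conditions of each kind: the even skew part is sl_2
  in the lower block, and each odd part is two-dimensional.\<close>

lemma mat_kind_mat3:
  "mat_kind YP (mat3 a 0 0 0 e 0 0 0 e)"
  "mat_kind YM (mat3 0 0 0 0 e f 0 h (- e))"
  "mat_kind ZP (mat3 0 b c c 0 0 (- b) 0 0)"
  "mat_kind ZM (mat3 0 b c (- c) 0 0 b 0 0)"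
  by (simp_all add: mat_kind_def kodd_def ksign_def M12_odd_def M12_even_def M12_star_def matrix3_eq_iff)

definition mlin6 :: "'a::field \<Rightarrow> 'a \<Rightarrow> 'a \<Rightarrow> 'a \<Rightarrow> 'a \<Rightarrow> 'a \<Rightarrow> 'a^3^3 \<Rightarrow> 'a^3^3 \<Rightarrow> 'a^3^3 \<Rightarrow> 'a^3^3" where
  "mlin6 c1 c2 c3 c4 c5 c6 A B C = smat c1 (A ** B ** C) + smat c2 (A ** C ** B)
     + smat c3 (B ** A ** C) + smat c4 (B ** C ** A) + smat c5 (C ** A ** B) + smat c6 (C ** B ** A)"

definition mlin6_identity :: "vkind \<Rightarrow> vkind \<Rightarrow> vkind \<Rightarrow> 'a::field \<Rightarrow> 'a \<Rightarrow> 'a \<Rightarrow> 'a \<Rightarrow> 'a \<Rightarrow> 'a \<Rightarrow> bool" where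
  "mlin6_identity k l m c1 c2 c3 c4 c5 c6 \<longleftrightarrow> (\<forall>A B C. mat_kind k A \<longrightarrow> mat_kind l B \<longrightarrow> mat_kind m C
     \<longrightarrow> mlin6 c1 c2 c3 c4 c5 c6 A B C = 0)"

text \<open>\<open>ymat1\<close> and \<open>ymat2\<close> are orthogonal idempotents with sum 1, and
  \<open>slE\<close>, \<open>slF\<close>, \<open>slH\<close> are the standard basis of sl_2 in the
  lower block.\<close>

abbreviation "ymat1 \<equiv> mat3 1 0 0 0 0 0 0 0 0"
abbreviation "ymat2 \<equiv> mat3 0 0 0 0 1 0 0 0 1"
abbreviation "slE \<equiv> mat3 0 0 0 0 0 1 0 0 0"
abbreviation "slF \<equiv> mat3 0 0 0 0 0 0 0 1 0"
abbreviation "slH \<equiv> mat3 0 0 0 0 1 0 0 0 (-1)"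

lemma mat_kind_basis:
  "mat_kind YP ymat1" "mat_kind YP ymat2" "mat_kind YM slE" "mat_kind YM slF" "mat_kind YM slH"
  using mat_kind_mat3(1)[of 1 0] mat_kind_mat3(1)[of 0 1] mat_kind_mat3(2)[of 0 1 0]
    mat_kind_mat3(2)[of 0 0 1] mat_kind_mat3(2)[of 1 0 0] by simp_all

text \<open>Both odd kinds share the first row as coordinates and differ only by signs in the first
  column, so that one choice of matrices serves both.\<close>

definition zmat :: "vkind \<Rightarrow> 'a::field \<Rightarrow> 'a \<Rightarrow> 'a^3^3" where
  "zmat k b c = (if k = ZP then mat3 0 b c c 0 0 (- b) 0 0 else mat3 0 b c (- c) 0 0 b 0 0)"

lemma mat_kind_zmat: "kodd k \<Longrightarrow> mat_kind k (zmat k b c)"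
  using mat_kind_mat3(3,4) by (auto simp: zmat_def kodd_def)

text \<open>The alternative \<open>- x\<close> absorbs the sign by which an entry can differ between
  the two odd kinds.\<close>

lemma mlin6_identity_entry:
  assumes "mlin6_identity k l m c1 c2 c3 c4 c5 c6" "mat_kind k A" "mat_kind l B" "mat_kind m C"
    and "mlin6 c1 c2 c3 c4 c5 c6 A B C $ i $ j = x \<or> mlin6 c1 c2 c3 c4 c5 c6 A B C $ i $ j = - x"
  shows "x = 0"
  using assms by (auto simp: mlin6_identity_def)

section \<open>Coefficient relations read off from matrix entries, by kinds of the letters\<close>

lemmas mlin6_eval = mlin6_def mat3_mult zmat_def

lemma mlin6_identity_YP_YP_even:
  assumes ident: "mlin6_identity YP YP k c1 c2 c3 c4 c5 c6" and "\<not> kodd k"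
  shows "c1 + c2 + c3 + c4 + c5 + c6 = 0"
proof -
  consider "k = YP" | "k = YM"
    using assms(2) by (cases k) (simp_all add: kodd_def)
  then show ?thesis
  proof cases
    case 1
    then show ?thesis
      by (intro mlin6_identity_entry[OF ident mat_kind_basis(2) mat_kind_basis(2), of ymat2 2 2])
         (simp_all add: mat_kind_basis mlin6_eval)
  next
    case 2
    then show ?thesis
      by (intro mlin6_identity_entry[OF ident mat_kind_basis(2) mat_kind_basis(2), of slE 2 3])
         (simp_all add: mat_kind_basis mlin6_eval)
  qed
qed

text \<open>\<open>ymat2\<close> acts as the unit of the lower block, and the products of
  \<open>slE\<close> and \<open>slF\<close> in the two orders sit at different diagonal places,
  which separates the orders of the skew letters.\<close>

lemma mlin6_identity_YP_YM_YM:
  assumes ident: "mlin6_identity YP YM YM c1 c2 c3 c4 c5 c6"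
  shows "c1 + c3 + c4 = 0" "c2 + c5 + c6 = 0"
proof -
  show "c1 + c3 + c4 = 0"
    by (rule mlin6_identity_entry[OF ident mat_kind_basis(2) mat_kind_basis(3) mat_kind_basis(4),
      of 2 2]) (simp add: mlin6_eval)
  show "c2 + c5 + c6 = 0"
    by (rule mlin6_identity_entry[OF ident mat_kind_basis(2) mat_kind_basis(3) mat_kind_basis(4),
      of 3 3]) (simp add: mlin6_eval)
qed

lemma mlin6_identity_YM_YM_YM:
  assumes ident: "mlin6_identity YM YM YM c1 c2 c3 c4 c5 c6"
  shows "c1 = c3 - c4" "c2 = - c4" "c5 = - c3" "c6 = c4 - c3"
proof -
  have 1: "c1 - c2 + c5 = 0"
    by (rule mlin6_identity_entry[OF ident mat_kind_basis(3) mat_kind_basis(4) mat_kind_basis(5),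
      of 2 2]) (simp add: mlin6_eval algebra_simps)
  have 2: "- c3 + c4 - c6 = 0"
    by (rule mlin6_identity_entry[OF ident mat_kind_basis(3) mat_kind_basis(4) mat_kind_basis(5),
      of 3 3]) (simp add: mlin6_eval algebra_simps)
  have 3: "- c1 + c2 + c3 = 0"
    by (rule mlin6_identity_entry[OF ident mat_kind_basis(3) mat_kind_basis(5) mat_kind_basis(4),
      of 2 2]) (simp add: mlin6_eval algebra_simps)
  have 4: "- c4 - c5 + c6 = 0"
    by (rule mlin6_identity_entry[OF ident mat_kind_basis(3) mat_kind_basis(5) mat_kind_basis(4),
      of 3 3]) (simp add: mlin6_eval algebra_simps)
  have 5: "c1 - c3 + c4 = 0"
    by (rule mlin6_identity_entry[OF ident mat_kind_basis(5) mat_kind_basis(3) mat_kind_basis(4),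
      of 2 2]) (simp add: mlin6_eval algebra_simps)
  have 6: "- c2 + c5 - c6 = 0"
    by (rule mlin6_identity_entry[OF ident mat_kind_basis(5) mat_kind_basis(3) mat_kind_basis(4),
      of 3 3]) (simp add: mlin6_eval algebra_simps)
  show "c1 = c3 - c4" "c2 = - c4" "c5 = - c3" "c6 = c4 - c3"
    using 1 2 3 4 5 6 by algebra+
qed

lemma kodd_odd: "kodd ZP" "kodd ZM"
  by (simp_all add: kodd_def)

text \<open>Taking \<open>ymat1\<close> twice leaves the words with the odd letter at an end. Taking
  the orthogonal \<open>ymat1\<close> and \<open>ymat2\<close> leaves only those with the odd letter
  in the middle.\<close>

lemma mlin6_identity_YP_YP_odd:
  assumes ident: "mlin6_identity YP YP k c1 c2 c3 c4 c5 c6" and odd: "kodd k"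
  shows "c3 = - c1" "c6 = - c5" "c2 = 0" "c4 = 0"
proof -
  have 1: "c1 + c3 = 0"
    by (rule mlin6_identity_entry[OF ident mat_kind_basis(1) mat_kind_basis(1) mat_kind_zmat[OF odd, of 1 0],
      of 1 2]) (use odd in \<open>cases k; simp add: kodd_def mlin6_eval algebra_simps\<close>)
  have 2: "c5 + c6 = 0"
    by (rule mlin6_identity_entry[OF ident mat_kind_basis(1) mat_kind_basis(1) mat_kind_zmat[OF odd, of 1 0],
      of 3 1]) (use odd in \<open>cases k; simp add: kodd_def mlin6_eval algebra_simps\<close>)
  have 3: "c2 = 0"
    by (rule mlin6_identity_entry[OF ident mat_kind_basis(1) mat_kind_basis(2) mat_kind_zmat[OF odd, of 1 0],
      of 1 2]) (use odd in \<open>cases k; simp add: kodd_def mlin6_eval algebra_simps\<close>)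
  have 4: "c4 = 0"
    by (rule mlin6_identity_entry[OF ident mat_kind_basis(1) mat_kind_basis(2) mat_kind_zmat[OF odd, of 1 0],
      of 3 1]) (use odd in \<open>cases k; simp add: kodd_def mlin6_eval algebra_simps\<close>)
  show "c3 = - c1" "c6 = - c5" "c2 = 0" "c4 = 0"
    using 1 2 3 4 by (simp_all add: add_eq_0_iff)
qed

lemma mlin6_identity_YP_YM_odd:
  assumes ident: "mlin6_identity YP YM k c1 c2 c3 c4 c5 c6" and odd: "kodd k"
  shows "c3 = - c1" "c6 = - c5" "c2 = 0" "c4 = 0"
proof -
  have 1: "c2 = 0"
    by (rule mlin6_identity_entry[OF ident mat_kind_basis(1) mat_kind_basis(5) mat_kind_zmat[OF odd, of 1 0],
      of 1 2]) (use odd in \<open>cases k; simp add: kodd_def mlin6_eval algebra_simps\<close>)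
  have 2: "c4 = 0"
    by (rule mlin6_identity_entry[OF ident mat_kind_basis(1) mat_kind_basis(5) mat_kind_zmat[OF odd, of 1 0],
      of 3 1]) (use odd in \<open>cases k; simp add: kodd_def mlin6_eval algebra_simps\<close>)
  have 3: "c1 + c3 = 0"
    by (rule mlin6_identity_entry[OF ident mat_kind_basis(2) mat_kind_basis(5) mat_kind_zmat[OF odd, of 1 0],
      of 3 1]) (use odd in \<open>cases k; simp add: kodd_def mlin6_eval algebra_simps\<close>)
  have 4: "c5 + c6 = 0"
    by (rule mlin6_identity_entry[OF ident mat_kind_basis(2) mat_kind_basis(5) mat_kind_zmat[OF odd, of 1 0],
      of 1 2]) (use odd in \<open>cases k; simp add: kodd_def mlin6_eval algebra_simps\<close>)
  show "c3 = - c1" "c6 = - c5" "c2 = 0" "c4 = 0"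
    using 1 2 3 4 by (simp_all add: add_eq_0_iff)
qed

text \<open>The four words with adjacent skew letters are isolated one by one; the two words with
  the odd letter in the middle vanish on matrices.\<close>

lemma mlin6_identity_YM_YM_odd:
  assumes ident: "mlin6_identity YM YM k c1 c2 c3 c4 c5 c6" and odd: "kodd k"
  shows "c1 = 0" "c3 = 0" "c5 = 0" "c6 = 0"
proof -
  have 1: "c3 = 0"
    by (rule mlin6_identity_entry[OF ident mat_kind_basis(3) mat_kind_basis(4) mat_kind_zmat[OF odd, of 1 0],
      of 3 1]) (use odd in \<open>cases k; simp add: kodd_def mlin6_eval algebra_simps\<close>)
  have 2: "c5 = 0"
    by (rule mlin6_identity_entry[OF ident mat_kind_basis(3) mat_kind_basis(4) mat_kind_zmat[OF odd, of 1 0],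
      of 1 2]) (use odd in \<open>cases k; simp add: kodd_def mlin6_eval algebra_simps\<close>)
  have 3: "c1 = 0"
    by (rule mlin6_identity_entry[OF ident mat_kind_basis(3) mat_kind_basis(4) mat_kind_zmat[OF odd, of 0 1],
      of 2 1]) (use odd in \<open>cases k; simp add: kodd_def mlin6_eval algebra_simps\<close>)
  have 4: "c6 = 0"
    by (rule mlin6_identity_entry[OF ident mat_kind_basis(3) mat_kind_basis(4) mat_kind_zmat[OF odd, of 0 1],
      of 1 3]) (use odd in \<open>cases k; simp add: kodd_def mlin6_eval algebra_simps\<close>)
  show "c1 = 0" "c3 = 0" "c5 = 0" "c6 = 0"
    by fact+
qed

lemma mlin6_identity_YP_odd_odd:
  assumes ident: "mlin6_identity YP k l c1 c2 c3 c4 c5 c6" and odd: "kodd k" "kodd l"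
  shows "c4 = - c1" "c6 = - c2" "c3 = 0" "c5 = 0"
proof -
  have 1: "c3 = 0"
    by (rule mlin6_identity_entry[OF ident mat_kind_basis(1) mat_kind_zmat[OF odd(1), of 1 0] mat_kind_zmat[OF odd(2), of 0 1],
      of 3 3]) (use odd in \<open>cases k; cases l; simp add: kodd_def mlin6_eval algebra_simps\<close>)
  have 2: "c5 = 0"
    by (rule mlin6_identity_entry[OF ident mat_kind_basis(1) mat_kind_zmat[OF odd(1), of 1 0] mat_kind_zmat[OF odd(2), of 0 1],
      of 2 2]) (use odd in \<open>cases k; cases l; simp add: kodd_def mlin6_eval algebra_simps\<close>)
  have 3: "c1 + c4 = 0"
    by (rule mlin6_identity_entry[OF ident mat_kind_basis(2) mat_kind_zmat[OF odd(1), of 1 0] mat_kind_zmat[OF odd(2), of 0 1],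
      of 3 3]) (use odd in \<open>cases k; cases l; simp add: kodd_def mlin6_eval algebra_simps\<close>)
  have 4: "c2 + c6 = 0"
    by (rule mlin6_identity_entry[OF ident mat_kind_basis(2) mat_kind_zmat[OF odd(1), of 1 0] mat_kind_zmat[OF odd(2), of 0 1],
      of 2 2]) (use odd in \<open>cases k; cases l; simp add: kodd_def mlin6_eval algebra_simps\<close>)
  show "c4 = - c1" "c6 = - c2" "c3 = 0" "c5 = 0"
    using 1 2 3 4 by (simp_all add: add_eq_0_iff)
qed

text \<open>\<open>slH\<close> sees the two orders of the odd letters at different lower diagonal
  places. Only \<open>slE\<close>, moving both into entry (2,3), compares \<open>c1\<close> with
  \<open>c6\<close>.\<close>

lemma mlin6_identity_YM_odd_odd_same:
  assumes ident: "mlin6_identity YM k k c1 c2 c3 c4 c5 c6" and odd: "kodd k"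
  shows "c2 = - c1" "c4 = - c1" "c6 = c1" "c5 = - c3"
proof -
  have 1: "c1 + c4 = 0"
    by (rule mlin6_identity_entry[OF ident mat_kind_basis(5) mat_kind_zmat[OF odd, of 1 0] mat_kind_zmat[OF odd, of 0 1],
      of 3 3]) (use odd in \<open>cases k; simp add: kodd_def mlin6_eval algebra_simps\<close>)
  have 2: "c2 + c6 = 0"
    by (rule mlin6_identity_entry[OF ident mat_kind_basis(5) mat_kind_zmat[OF odd, of 1 0] mat_kind_zmat[OF odd, of 0 1],
      of 2 2]) (use odd in \<open>cases k; simp add: kodd_def mlin6_eval algebra_simps\<close>)
  have 3: "c3 + c5 = 0"
    by (rule mlin6_identity_entry[OF ident mat_kind_basis(5) mat_kind_zmat[OF odd, of 1 0] mat_kind_zmat[OF odd, of 0 1],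
      of 1 1]) (use odd in \<open>cases k; simp add: kodd_def mlin6_eval algebra_simps\<close>)
  have 4: "c1 - c6 = 0"
    by (rule mlin6_identity_entry[OF ident mat_kind_basis(3) mat_kind_zmat[OF odd, of 1 0] mat_kind_zmat[OF odd, of 0 1],
      of 2 3]) (use odd in \<open>cases k; simp add: kodd_def mlin6_eval algebra_simps\<close>)
  show "c2 = - c1" "c4 = - c1" "c6 = c1" "c5 = - c3"
    using 1 2 3 4 by algebra+
qed

lemma mlin6_identity_YM_odd_odd_opposite:
  assumes ident: "mlin6_identity YM ZP ZM c1 c2 c3 c4 c5 c6"
  shows "c2 = c1" "c4 = - c1" "c6 = - c1" "c5 = c3"
proof -
  have 1: "c1 + c4 = 0"
    by (rule mlin6_identity_entry[OF ident mat_kind_basis(5) mat_kind_zmat[OF kodd_odd(1), of 1 0] mat_kind_zmat[OF kodd_odd(2), of 0 1],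
      of 3 3]) (simp add: mlin6_eval algebra_simps)
  have 2: "c2 + c6 = 0"
    by (rule mlin6_identity_entry[OF ident mat_kind_basis(5) mat_kind_zmat[OF kodd_odd(1), of 1 0] mat_kind_zmat[OF kodd_odd(2), of 0 1],
      of 2 2]) (simp add: mlin6_eval algebra_simps)
  have 3: "c3 - c5 = 0"
    by (rule mlin6_identity_entry[OF ident mat_kind_basis(5) mat_kind_zmat[OF kodd_odd(1), of 1 0] mat_kind_zmat[OF kodd_odd(2), of 0 1],
      of 1 1]) (simp add: mlin6_eval algebra_simps)
  have 4: "c1 + c6 = 0"
    by (rule mlin6_identity_entry[OF ident mat_kind_basis(3) mat_kind_zmat[OF kodd_odd(1), of 1 0] mat_kind_zmat[OF kodd_odd(2), of 0 1],
      of 2 3]) (simp add: mlin6_eval algebra_simps)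
  show "c2 = c1" "c4 = - c1" "c6 = - c1" "c5 = c3"
    using 1 2 3 4 by algebra+
qed

text \<open>The system leaves two free parameters. Characteristic zero enters through the
  cancellation of 3.\<close>

lemma six_coefficients_eq:
  fixes c1 c2 c3 c4 c5 c6 :: "'a::field_char_0"
  assumes "c2 + c4 - c5 - c6 = 0" "c1 + c3 - c2 - c4 = 0" "c1 + c6 - c3 - c4 = 0"
    "c2 + c5 - c1 - c6 = 0" "c3 + c5 - c1 - c2 = 0" "c4 + c6 - c3 - c5 = 0"
  shows "c4 = c1" "c5 = c1" "c3 = c2" "c6 = c2"
proof -
  have "3 * (c1 + c3) = 3 * (c1 + c6)" "3 * (c1 + c3) = 3 * (c1 + c2)"
    using assms by algebra+
  then have "c3 = c6" "c3 = c2"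
    by simp_all
  then show "c3 = c2" "c6 = c2"
    by simp_all
  show "c4 = c1"
    using assms(3) \<open>c3 = c6\<close> by simp
  show "c5 = c1"
    using assms(5) \<open>c3 = c2\<close> by algebra
qed

text \<open>The exceptional matrix \<open>zmat k 0 1\<close> runs through the three slots, and each
  position contributes the entries (1,2) and (3,1).\<close>

lemma mlin6_identity_odd_same:
  fixes c1 :: "'a::field_char_0"
  assumes ident: "mlin6_identity k k k c1 c2 c3 c4 c5 c6" and odd: "kodd k"
  shows "c4 = c1" "c5 = c1" "c3 = c2" "c6 = c2"
proof -
  have 1: "c2 + c4 - c5 - c6 = 0"
    by (rule mlin6_identity_entry[OF ident mat_kind_zmat[OF odd, of 1 0] mat_kind_zmat[OF odd, of 1 0] mat_kind_zmat[OF odd, of 0 1],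
      of 1 2]) (use odd in \<open>cases k; simp add: kodd_def mlin6_eval algebra_simps\<close>)
  have 2: "c1 + c3 - c2 - c4 = 0"
    by (rule mlin6_identity_entry[OF ident mat_kind_zmat[OF odd, of 1 0] mat_kind_zmat[OF odd, of 1 0] mat_kind_zmat[OF odd, of 0 1],
      of 3 1]) (use odd in \<open>cases k; simp add: kodd_def mlin6_eval algebra_simps\<close>)
  have 3: "c1 + c6 - c3 - c4 = 0"
    by (rule mlin6_identity_entry[OF ident mat_kind_zmat[OF odd, of 1 0] mat_kind_zmat[OF odd, of 0 1] mat_kind_zmat[OF odd, of 1 0],
      of 1 2]) (use odd in \<open>cases k; simp add: kodd_def mlin6_eval algebra_simps\<close>)
  have 4: "c2 + c5 - c1 - c6 = 0"
    by (rule mlin6_identity_entry[OF ident mat_kind_zmat[OF odd, of 1 0] mat_kind_zmat[OF odd, of 0 1] mat_kind_zmat[OF odd, of 1 0],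
      of 3 1]) (use odd in \<open>cases k; simp add: kodd_def mlin6_eval algebra_simps\<close>)
  have 5: "c3 + c5 - c1 - c2 = 0"
    by (rule mlin6_identity_entry[OF ident mat_kind_zmat[OF odd, of 0 1] mat_kind_zmat[OF odd, of 1 0] mat_kind_zmat[OF odd, of 1 0],
      of 1 2]) (use odd in \<open>cases k; simp add: kodd_def mlin6_eval algebra_simps\<close>)
  have 6: "c4 + c6 - c3 - c5 = 0"
    by (rule mlin6_identity_entry[OF ident mat_kind_zmat[OF odd, of 0 1] mat_kind_zmat[OF odd, of 1 0] mat_kind_zmat[OF odd, of 1 0],
      of 3 1]) (use odd in \<open>cases k; simp add: kodd_def mlin6_eval algebra_simps\<close>)
  show "c4 = c1" "c5 = c1" "c3 = c2" "c6 = c2"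
    using six_coefficients_eq[OF 1 2 3 4 5 6] by auto
qed

lemma mlin6_identity_odd_mixed:
  fixes c1 :: "'a::field_char_0"
  assumes ident: "mlin6_identity k k l c1 c2 c3 c4 c5 c6" and odd: "kodd k" "kodd l" "k \<noteq> l"
  shows "c4 = - c1" "c5 = c1" "c2 = - c3" "c6 = c3"
proof -
  \<comment> \<open>The relations are those of equal kinds with \<open>c2\<close> and
    \<open>c4\<close> negated, and are written so as to match
    \<open>six_coefficients_eq\<close>.\<close>
  have 1: "- c2 + - c4 - c5 - c6 = 0"
    by (rule mlin6_identity_entry[OF ident mat_kind_zmat[OF odd(1), of 1 0] mat_kind_zmat[OF odd(1), of 1 0] mat_kind_zmat[OF odd(2), of 0 1],
      of 1 2]) (use odd in \<open>cases k; cases l; simp add: kodd_def mlin6_eval algebra_simps\<close>)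
  have 2: "c1 + c3 - - c2 - - c4 = 0"
    by (rule mlin6_identity_entry[OF ident mat_kind_zmat[OF odd(1), of 1 0] mat_kind_zmat[OF odd(1), of 1 0] mat_kind_zmat[OF odd(2), of 0 1],
      of 3 1]) (use odd in \<open>cases k; cases l; simp add: kodd_def mlin6_eval algebra_simps\<close>)
  have 3: "c1 + c6 - c3 - - c4 = 0"
    by (rule mlin6_identity_entry[OF ident mat_kind_zmat[OF odd(1), of 1 0] mat_kind_zmat[OF odd(1), of 0 1] mat_kind_zmat[OF odd(2), of 1 0],
      of 1 2]) (use odd in \<open>cases k; cases l; simp add: kodd_def mlin6_eval algebra_simps\<close>)
  have 4: "- c2 + c5 - c1 - c6 = 0"
    by (rule mlin6_identity_entry[OF ident mat_kind_zmat[OF odd(1), of 1 0] mat_kind_zmat[OF odd(1), of 0 1] mat_kind_zmat[OF odd(2), of 1 0],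
      of 3 1]) (use odd in \<open>cases k; cases l; simp add: kodd_def mlin6_eval algebra_simps\<close>)
  have 5: "c3 + c5 - c1 - - c2 = 0"
    by (rule mlin6_identity_entry[OF ident mat_kind_zmat[OF odd(1), of 0 1] mat_kind_zmat[OF odd(1), of 1 0] mat_kind_zmat[OF odd(2), of 1 0],
      of 1 2]) (use odd in \<open>cases k; cases l; simp add: kodd_def mlin6_eval algebra_simps\<close>)
  have 6: "- c4 + c6 - c3 - c5 = 0"
    by (rule mlin6_identity_entry[OF ident mat_kind_zmat[OF odd(1), of 0 1] mat_kind_zmat[OF odd(1), of 1 0] mat_kind_zmat[OF odd(2), of 1 0],
      of 3 1]) (use odd in \<open>cases k; cases l; simp add: kodd_def mlin6_eval algebra_simps\<close>)
  show "c4 = - c1" "c5 = c1" "c2 = - c3" "c6 = c3"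
    using six_coefficients_eq[OF 1 2 3 4 5 6] by auto
qed

section \<open>Multilinear identities of degree 3 lie in the ideal\<close>

context M12_T2star_ideal
begin

definition lin6_good :: "vkind \<Rightarrow> vkind \<Rightarrow> vkind \<Rightarrow> bool" where
  "lin6_good k l m \<longleftrightarrow> (\<forall>c1 c2 c3 c4 c5 c6 p q r. mlin6_identity k l m c1 c2 c3 c4 c5 c6 \<longrightarrow>
     fpoly_kind k p \<longrightarrow> fpoly_kind l q \<longrightarrow> fpoly_kind m r \<longrightarrow> lin6 c1 c2 c3 c4 c5 c6 p q r \<in> J)"

text \<open>Renaming the factors permutes the coefficients in the same way for polynomials and for
  matrices, so the order of the kinds does not matter.\<close>

lemma lin6_good_swap12:
  assumes "lin6_good k l m"
  shows "lin6_good l k m"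
proof -
  have "lin6 c1 c2 c3 c4 c5 c6 p q r = lin6 c3 c4 c1 c2 c6 c5 q p r"
    for c1 c2 c3 c4 c5 c6 and p q r :: "'a fpoly"
    by (simp add: lin6_def add_ac)
  moreover have "mlin6_identity l k m c1 c2 c3 c4 c5 c6 \<Longrightarrow> mlin6_identity k l m c3 c4 c1 c2 c6 c5"
    for c1 c2 c3 c4 c5 c6 :: 'a
    by (simp add: mlin6_identity_def mlin6_def add_ac)
  ultimately show ?thesis
    using assms unfolding lin6_good_def by metis
qed

lemma lin6_good_swap23:
  assumes "lin6_good k l m"
  shows "lin6_good k m l"
proof -
  have "lin6 c1 c2 c3 c4 c5 c6 p q r = lin6 c2 c1 c5 c6 c3 c4 p r q"
    for c1 c2 c3 c4 c5 c6 and p q r :: "'a fpoly"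
    by (simp add: lin6_def add_ac)
  moreover have "mlin6_identity k m l c1 c2 c3 c4 c5 c6 \<Longrightarrow> mlin6_identity k l m c2 c1 c5 c6 c3 c4"
    for c1 c2 c3 c4 c5 c6 :: 'a
    by (simp add: mlin6_identity_def mlin6_def add_ac)
  ultimately show ?thesis
    using assms unfolding lin6_good_def by metis
qed

lemma lin6_goodI:
  assumes "\<And>c1 c2 c3 c4 c5 c6 p q r. \<lbrakk>mlin6_identity k l m c1 c2 c3 c4 c5 c6;
    fpoly_kind k p; fpoly_kind l q; fpoly_kind m r\<rbrakk> \<Longrightarrow> lin6 c1 c2 c3 c4 c5 c6 p q r \<in> J"
  shows "lin6_good k l m"
  using assms unfolding lin6_good_def by blast

lemma lin6_good_YP_YP_YP: "lin6_good YP YP YP"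
  by (rule lin6_goodI, rule lin6_mem_commuting)
     (auto intro: comm_YP_YP_mem dest: mlin6_identity_YP_YP_even simp: kodd_def)

lemma lin6_good_YP_YP_YM: "lin6_good YP YP YM"
  by (rule lin6_goodI, rule lin6_mem_commuting)
     (auto intro: comm_YP_YP_mem comm_YP_YM_mem dest: mlin6_identity_YP_YP_even simp: kodd_def)

lemma lin6_good_YP_YM_YM: "lin6_good YP YM YM"
  by (rule lin6_goodI, rule lin6_mem_first_commuting)
     (assumption | rule comm_YP_YM_mem | erule mlin6_identity_YP_YM_YM)+

lemma lin6_good_YM_YM_YM: "lin6_good YM YM YM"
  by (rule lin6_goodI, rule lin6_mem_skew)
     (assumption | erule mlin6_identity_YM_YM_YM)+

lemma lin6_good_YP_YP_odd: "kodd k \<Longrightarrow> lin6_good YP YP k"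
  by (rule lin6_goodI, rule lin6_mem_commuting_pair)
     (assumption | rule comm_YP_YP_mem | erule mlin6_identity_YP_YP_odd)+

lemma lin6_good_YP_YM_odd: "kodd k \<Longrightarrow> lin6_good YP YM k"
  by (rule lin6_goodI, rule lin6_mem_commuting_pair)
     (assumption | rule comm_YP_YM_mem | erule mlin6_identity_YP_YM_odd)+

lemma lin6_good_YM_YM_odd: "kodd k \<Longrightarrow> lin6_good YM YM k"
  by (rule lin6_goodI, rule lin6_mem_skew_skew_odd)
     (assumption | erule mlin6_identity_YM_YM_odd)+

lemma lin6_good_YP_odd_odd: "kodd k \<Longrightarrow> kodd l \<Longrightarrow> lin6_good YP k l"
  by (rule lin6_goodI, rule lin6_mem_sym_odd_odd)
     (assumption | erule mlin6_identity_YP_odd_odd)+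

lemma lin6_good_YM_odd_odd_same: "kodd k \<Longrightarrow> lin6_good YM k k"
  by (rule lin6_goodI, rule lin6_mem_skew_odd_odd_same)
     (assumption | erule mlin6_identity_YM_odd_odd_same)+

lemma lin6_good_YM_odd_odd_opposite: "lin6_good YM ZP ZM"
  by (rule lin6_goodI, rule lin6_mem_skew_odd_odd_opposite)
     (assumption | erule mlin6_identity_YM_odd_odd_opposite)+

lemma lin6_good_odd_same: "kodd k \<Longrightarrow> lin6_good k k k"
  by (rule lin6_goodI, rule lin6_mem_odd_same)
     (assumption | erule mlin6_identity_odd_same)+

lemma lin6_good_odd_mixed: "kodd k \<Longrightarrow> kodd l \<Longrightarrow> k \<noteq> l \<Longrightarrow> lin6_good k k l"
  by (rule lin6_goodI, rule lin6_mem_odd_mixed)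
     (assumption | erule mlin6_identity_odd_mixed)+

lemma lin6_good_all: "lin6_good k l m"
proof -
  have z: "kodd ZP" "kodd ZM" by (simp_all add: kodd_def)
  \<comment> \<open>Twenty facts, one for each multiset of three kinds.\<close>
  note base = lin6_good_YP_YP_YP lin6_good_YP_YP_YM lin6_good_YP_YM_YM lin6_good_YM_YM_YM
    lin6_good_YP_YP_odd[OF z(1)] lin6_good_YP_YP_odd[OF z(2)]
    lin6_good_YP_YM_odd[OF z(1)] lin6_good_YP_YM_odd[OF z(2)]
    lin6_good_YM_YM_odd[OF z(1)] lin6_good_YM_YM_odd[OF z(2)]
    lin6_good_YP_odd_odd[OF z(1) z(1)] lin6_good_YP_odd_odd[OF z(1) z(2)] lin6_good_YP_odd_odd[OF z(2) z(2)]
    lin6_good_YM_odd_odd_same[OF z(1)] lin6_good_YM_odd_odd_same[OF z(2)] lin6_good_YM_odd_odd_opposite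
    lin6_good_odd_same[OF z(1)] lin6_good_odd_same[OF z(2)]
    lin6_good_odd_mixed[OF z(1) z(2)] lin6_good_odd_mixed[OF z(2) z(1)]
  have perms: "lin6_good k m l \<and> lin6_good l k m \<and> lin6_good l m k \<and> lin6_good m k l \<and> lin6_good m l k"
    if "lin6_good k l m" for k l m
    using that by (blast intro: lin6_good_swap12 lin6_good_swap23)
  show ?thesis
    by (cases k; cases l; cases m) (simp_all add: base base[THEN perms])
qed

end

section \<open>Polarization\<close>

definition fletter :: "var \<Rightarrow> 'a::ring_1 fpoly" where
  "fletter x = fvar (fst x) (snd x)"

lemma fpoly_kind_fletter: "fpoly_kind (fst x) (fletter x)"
  by (simp add: fletter_def)

lemma fpoly_kind_one: "fpoly_kind YP 1"
  by (simp add: fpoly_kind_def fpoly_parity_one kodd_def ksign_def)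

definition letters :: "'a::zero fpoly \<Rightarrow> var set" where
  "letters f = (\<Union>w\<in>Poly_Mapping.keys f. set (wlist w))"

lemma finite_letters: "finite (letters f)"
  by (simp add: letters_def)

lemma sum_lists_Suc:
  fixes h :: "'b list \<Rightarrow> 'c::comm_monoid_add"
  shows "(\<Sum>xs | set xs \<subseteq> V \<and> length xs = Suc n. h xs)
    = (\<Sum>x\<in>V. \<Sum>xs | set xs \<subseteq> V \<and> length xs = n. h (x # xs))"
proof -
  have "(\<Sum>xs | set xs \<subseteq> V \<and> length xs = Suc n. h xs)
      = (\<Sum>(x, xs)\<in>V \<times> {xs. set xs \<subseteq> V \<and> length xs = n}. h (x # xs))"
    by (rule sum.reindex_bij_witness[where i = "\<lambda>(x, xs). x # xs" and j = "\<lambda>xs. (hd xs, tl xs)"])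
       (auto simp: length_Suc_conv)
  then show ?thesis
    by (simp add: sum.cartesian_product)
qed

text \<open>Since \<open>h\<close> vanishes off the keys, the sum extends to all words of length at
  most 3 over the finite alphabet. A general \<open>h\<close> covers both the polynomial itself and
  its evaluation.\<close>

lemma sum_keys_fdeg_le_3:
  fixes h :: "word \<Rightarrow> 'c::comm_monoid_add"
  assumes deg: "fdeg_le f 3" and V: "V = letters f"
    and h: "\<And>w. w \<notin> Poly_Mapping.keys f \<Longrightarrow> h w = 0"
  shows "(\<Sum>w\<in>Poly_Mapping.keys f. h w) = h (W []) + (\<Sum>x\<in>V. h (W [x]))
    + (\<Sum>x\<in>V. \<Sum>y\<in>V. h (W [x, y])) + (\<Sum>x\<in>V. \<Sum>y\<in>V. \<Sum>z\<in>V. h (W [x, y, z]))"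
proof -
  define L where "L n = {xs. set xs \<subseteq> V \<and> length xs = n}" for n
  have fin: "finite (L n)" for n
    unfolding L_def V using finite_lists_length_eq[OF finite_letters] by blast
  have layer: "(\<Sum>w | w \<in> Poly_Mapping.keys f \<and> wdeg w = n. h w) = (\<Sum>xs\<in>L n. h (W xs))" for n
  proof -
    have "(\<Sum>w | w \<in> Poly_Mapping.keys f \<and> wdeg w = n. h w) = (\<Sum>w\<in>W ` L n. h w)"
    proof (rule sum.mono_neutral_left)
      show "{w \<in> Poly_Mapping.keys f. wdeg w = n} \<subseteq> W ` L n"
      proof
        fix w assume "w \<in> {w \<in> Poly_Mapping.keys f. wdeg w = n}"
        then have "wlist w \<in> L n"
          by (auto simp: L_def V letters_def wdeg_def)
        moreover have "w = W (wlist w)"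
          by (cases w) simp
        ultimately show "w \<in> W ` L n"
          by (metis imageI)
      qed
      show "\<forall>w\<in>W ` L n - {w \<in> Poly_Mapping.keys f. wdeg w = n}. h w = 0"
        using h by (fastforce simp: L_def wdeg_def)
    qed (simp add: fin)
    also have "\<dots> = (\<Sum>xs\<in>L n. h (W xs))"
      by (simp add: sum.reindex inj_on_def)
    finally show ?thesis .
  qed
  have L0: "L 0 = {[]}"
    by (auto simp: L_def)
  have L_Suc: "(\<Sum>xs\<in>L (Suc n). g xs) = (\<Sum>x\<in>V. \<Sum>xs\<in>L n. g (x # xs))" for n and g :: "var list \<Rightarrow> 'c"
    unfolding L_def by (rule sum_lists_Suc)
  have "(\<Sum>w\<in>Poly_Mapping.keys f. h w)
      = (\<Sum>n\<in>{..3}. \<Sum>w | w \<in> Poly_Mapping.keys f \<and> wdeg w = n. h w)"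
    by (rule sum.group[symmetric]) (use deg in \<open>auto simp: fdeg_le_def\<close>)
  also have "\<dots> = (\<Sum>n\<in>{..3}. \<Sum>xs\<in>L n. h (W xs))"
    by (simp only: layer)
  also have "\<dots> = (\<Sum>xs\<in>L 0. h (W xs)) + (\<Sum>xs\<in>L (Suc 0). h (W xs))
      + (\<Sum>xs\<in>L (Suc (Suc 0)). h (W xs)) + (\<Sum>xs\<in>L (Suc (Suc (Suc 0))). h (W xs))"
    by (simp add: numeral_3_eq_3)
  finally show ?thesis
    by (simp add: L_Suc L0)
qed

lemma smat_zero_left [simp]: "smat 0 A = 0"
  by (simp add: matrix3_eq_iff)

lemma smat_zero_right [simp]: "smat c 0 = 0"
  by (simp add: matrix3_eq_iff)

lemma smat_add_right: "smat c (A + B) = smat c A + smat c B"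
  by (simp add: matrix3_eq_iff algebra_simps)

lemma smat_sum_right: "smat c (sum h X) = (\<Sum>x\<in>X. smat c (h x))"
  by (induction X rule: infinite_finite_induct) (simp_all add: smat_add_right)

lemma smat_smat: "smat c (smat d A) = smat (c * d) A"
  by (simp add: matrix3_eq_iff)

lemma smat_mult_left: "smat c A ** B = smat c (A ** B)"
  by (simp add: matrix3_eq_iff matrix_matrix_mult_def sum_3 algebra_simps)

lemma smat_mult_right: "A ** smat c B = smat c (A ** B)"
  by (simp add: matrix3_eq_iff matrix_matrix_mult_def sum_3 algebra_simps)

lemma matrix3_mult_zero [simp]: "A ** 0 = 0" "0 ** A = 0" for A :: "'a::field^3^3"
  by (simp_all add: vec_eq_iff matrix_matrix_mult_def)

lemma matrix3_add_mult: "A ** (B + C) = A ** B + A ** C" "(B + C) ** A = B ** A + C ** A"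
  for A B C :: "'a::field^3^3"
  by (simp_all add: vec_eq_iff matrix_matrix_mult_def algebra_simps sum.distrib)

lemma cubic_vanishing:
  fixes a0 a1 a2 a3 :: "'a::field_char_0"
  assumes "\<And>t. a0 + t * a1 + t * t * a2 + t * t * t * a3 = 0"
  shows "a0 = 0" "a1 = 0" "a2 = 0" "a3 = 0"
proof -
  show a0: "a0 = 0"
    using assms[of 0] by simp
  have 1: "a1 + a2 + a3 = 0" and 2: "- a1 + a2 - a3 = 0" and 3: "2 * a1 + 4 * a2 + 8 * a3 = 0"
    using assms[of 1] assms[of "- 1"] assms[of 2] a0 by simp_all
  have "2 * a2 = 0"
    using 1 2 by algebra
  then show a2: "a2 = 0"
    by simp
  have "6 * a3 = 0"
    using 1 3 a2 by algebra
  then show a3: "a3 = 0"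
    by simp
  show "a1 = 0"
    using 1 a2 a3 by simp
qed

text \<open>A substitution supported at one letter: inserted into a multilinear form, it isolates a
  single coefficient.\<close>

definition delta_subst :: "var \<Rightarrow> 'a::zero \<Rightarrow> var \<Rightarrow> 'a" where
  "delta_subst x A y = (if y = x then A else 0)"

text \<open>Each position has its own substitution; on the diagonal this evaluates a quadratic
  component.\<close>

definition bilin :: "var set \<Rightarrow> (var \<Rightarrow> var \<Rightarrow> 'a::field) \<Rightarrow> (var \<Rightarrow> 'a^3^3) \<Rightarrow> (var \<Rightarrow> 'a^3^3) \<Rightarrow> 'a^3^3" where
  "bilin V c \<alpha> \<beta> = (\<Sum>x\<in>V. \<Sum>y\<in>V. smat (c x y) (\<alpha> x ** \<beta> y))"

definition trilin :: "var set \<Rightarrow> (var \<Rightarrow> var \<Rightarrow> var \<Rightarrow> 'a::field) \<Rightarrow>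
    (var \<Rightarrow> 'a^3^3) \<Rightarrow> (var \<Rightarrow> 'a^3^3) \<Rightarrow> (var \<Rightarrow> 'a^3^3) \<Rightarrow> 'a^3^3" where
  "trilin V c \<alpha> \<beta> \<gamma> = (\<Sum>x\<in>V. \<Sum>y\<in>V. \<Sum>z\<in>V. smat (c x y z) (\<alpha> x ** \<beta> y ** \<gamma> z))"

lemma bilin_add:
  "bilin V c (\<lambda>x. \<alpha> x + \<alpha>' x) \<beta> = bilin V c \<alpha> \<beta> + bilin V c \<alpha>' \<beta>"
  "bilin V c \<alpha> (\<lambda>x. \<beta> x + \<beta>' x) = bilin V c \<alpha> \<beta> + bilin V c \<alpha> \<beta>'"
  by (simp_all add: bilin_def matrix3_add_mult smat_add_right sum.distrib)

lemma trilin_add: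
  "trilin V c (\<lambda>x. \<alpha> x + \<alpha>' x) \<beta> \<gamma> = trilin V c \<alpha> \<beta> \<gamma> + trilin V c \<alpha>' \<beta> \<gamma>"
  "trilin V c \<alpha> (\<lambda>x. \<beta> x + \<beta>' x) \<gamma> = trilin V c \<alpha> \<beta> \<gamma> + trilin V c \<alpha> \<beta>' \<gamma>"
  "trilin V c \<alpha> \<beta> (\<lambda>x. \<gamma> x + \<gamma>' x) = trilin V c \<alpha> \<beta> \<gamma> + trilin V c \<alpha> \<beta> \<gamma>'"
  by (simp_all add: trilin_def matrix3_add_mult smat_add_right sum.distrib)

lemma sum_delta_subst:
  fixes A :: "'a::zero" and g :: "var \<Rightarrow> 'a \<Rightarrow> 'c::comm_monoid_add"
  assumes "finite V" "x \<in> V" "\<And>y. g y 0 = 0"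
  shows "(\<Sum>y\<in>V. g y (delta_subst x A y)) = g x A"
proof -
  have "(\<Sum>y\<in>V. g y (delta_subst x A y)) = (\<Sum>y\<in>V. if y = x then g y A else 0)"
    by (rule sum.cong) (simp_all add: delta_subst_def assms(3))
  then show ?thesis
    using assms by simp
qed

lemma bilin_delta:
  assumes "finite V" "x \<in> V" "y \<in> V"
  shows "bilin V c (delta_subst x A) (delta_subst y B) = smat (c x y) (A ** B)"
  unfolding bilin_def
  by (subst sum_delta_subst[OF assms(1,3)], simp)
     (subst sum_delta_subst[OF assms(1,2), where g = "\<lambda>u A. smat (c u y) (A ** B)"], simp_all)

lemma trilin_delta:
  assumes "finite V" "x \<in> V" "y \<in> V" "z \<in> V"
  shows "trilin V c (delta_subst x A) (delta_subst y B) (delta_subst z C) = smat (c x y z) (A ** B ** C)"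
proof -
  have "trilin V c (delta_subst x A) (delta_subst y B) (delta_subst z C)
      = (\<Sum>u\<in>V. \<Sum>v\<in>V. smat (c u v z) (delta_subst x A u ** delta_subst y B v ** C))"
    unfolding trilin_def
    by (intro sum.cong refl sum_delta_subst[OF assms(1,4), where g = "\<lambda>w C. smat (c _ _ w) (_ ** _ ** C)"])
       simp
  also have "\<dots> = (\<Sum>u\<in>V. smat (c u y z) (delta_subst x A u ** B ** C))"
    by (intro sum.cong refl sum_delta_subst[OF assms(1,3), where g = "\<lambda>v B. smat (c _ v z) (_ ** B ** C)"])
       simp
  also have "\<dots> = smat (c x y z) (A ** B ** C)"
    by (rule sum_delta_subst[OF assms(1,2), where g = "\<lambda>u A. smat (c u y z) (A ** B ** C)"]) simp
  finally show ?thesis .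
qed

lemma polarize_bilin:
  assumes "\<And>\<sigma>. M12_admissible \<sigma> \<Longrightarrow> bilin V c \<sigma> \<sigma> = 0" "M12_admissible \<alpha>" "M12_admissible \<beta>"
  shows "bilin V c \<alpha> \<beta> + bilin V c \<beta> \<alpha> = 0"
proof -
  have "M12_admissible (\<lambda>x. \<alpha> x + \<beta> x)"
    using assms(2,3) by (simp add: M12_admissible_iff mat_kind_add)
  from assms(1)[OF this] assms(1)[OF assms(2)] assms(1)[OF assms(3)] show ?thesis
    by (simp add: bilin_add add_ac)
qed

lemma polarize_trilin:
  assumes diag: "\<And>\<sigma>. M12_admissible \<sigma> \<Longrightarrow> trilin V c \<sigma> \<sigma> \<sigma> = 0"
    and adm: "M12_admissible \<alpha>" "M12_admissible \<beta>" "M12_admissible \<gamma>"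
  shows "trilin V c \<alpha> \<beta> \<gamma> + trilin V c \<alpha> \<gamma> \<beta> + trilin V c \<beta> \<alpha> \<gamma> + trilin V c \<beta> \<gamma> \<alpha>
    + trilin V c \<gamma> \<alpha> \<beta> + trilin V c \<gamma> \<beta> \<alpha> = 0"
proof -
  let ?D = "\<lambda>\<sigma>. trilin V c \<sigma> \<sigma> \<sigma>"
  have sums: "M12_admissible (\<lambda>x. \<sigma> x + \<tau> x)" if "M12_admissible \<sigma>" "M12_admissible \<tau>" for \<sigma> \<tau> :: "var \<Rightarrow> 'a^3^3"
    using that by (simp add: M12_admissible_iff mat_kind_add)
  \<comment> \<open>Inclusion-exclusion over the nonempty subsets of the three substitutions leaves
    exactly the terms in which each occurs once.\<close>
  have "trilin V c \<alpha> \<beta> \<gamma> + trilin V c \<alpha> \<gamma> \<beta> + trilin V c \<beta> \<alpha> \<gamma> + trilin V c \<beta> \<gamma> \<alpha>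
      + trilin V c \<gamma> \<alpha> \<beta> + trilin V c \<gamma> \<beta> \<alpha>
    = ?D (\<lambda>x. \<alpha> x + \<beta> x + \<gamma> x) - ?D (\<lambda>x. \<alpha> x + \<beta> x) - ?D (\<lambda>x. \<alpha> x + \<gamma> x) - ?D (\<lambda>x. \<beta> x + \<gamma> x)
      + ?D \<alpha> + ?D \<beta> + ?D \<gamma>"
    by (simp add: trilin_add)
  also have "\<dots> = 0"
    by (simp add: diag adm sums)
  finally show ?thesis .
qed

lemma M12_admissible_delta:
  assumes "mat_kind (fst x) A"
  shows "M12_admissible (delta_subst x A)"
  using assms by (auto simp: M12_admissible_iff delta_subst_def mat_kind_zero)

lemma sum_symmetrize3:
  fixes h :: "'b \<Rightarrow> 'b \<Rightarrow> 'b \<Rightarrow> 'c::comm_monoid_add"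
  shows "(\<Sum>x\<in>V. \<Sum>y\<in>V. \<Sum>z\<in>V. h x y z + h x z y + h y x z + h y z x + h z x y + h z y x)
    = (let s = (\<Sum>x\<in>V. \<Sum>y\<in>V. \<Sum>z\<in>V. h x y z) in s + s + s + s + s + s)"
proof -
  let ?S = "\<lambda>h. \<Sum>x\<in>V. \<Sum>y\<in>V. \<Sum>z\<in>V. (h x y z :: 'c)"
  have s23: "?S (\<lambda>x y z. h x z y) = ?S h" for h
    by (intro sum.cong refl sum.swap)
  have s12: "?S (\<lambda>x y z. h y x z) = ?S h" for h
    by (rule sum.swap)
  have "?S (\<lambda>x y z. h y z x) = ?S h"
    using s12[of "\<lambda>x y z. h x z y"] s23[of h] by simp
  moreover have "?S (\<lambda>x y z. h z x y) = ?S h"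
    using s23[of "\<lambda>x y z. h y x z"] s12[of h] by simp
  moreover have "?S (\<lambda>x y z. h z y x) = ?S h"
    using s23[of "\<lambda>x y z. h y z x"] calculation(1) by simp
  ultimately show ?thesis
    using s23[of h] s12[of h] by (simp add: sum.distrib Let_def)
qed

section \<open>Membership of the homogeneous components\<close>

context M12_T2star_ideal
begin

lemma lin6_mem:
  assumes "mlin6_identity k l m c1 c2 c3 c4 c5 c6" "fpoly_kind k p" "fpoly_kind l q" "fpoly_kind m r"
  shows "lin6 c1 c2 c3 c4 c5 c6 p q r \<in> J"
  using lin6_good_all assms unfolding lin6_good_def by blast

lemma trilin_identity_mem:
  assumes V: "finite V" and diag: "\<And>\<sigma>. M12_admissible \<sigma> \<Longrightarrow> trilin V c \<sigma> \<sigma> \<sigma> = 0"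
  shows "(\<Sum>x\<in>V. \<Sum>y\<in>V. \<Sum>z\<in>V. fsmult (c x y z) (fletter x * fletter y * fletter z)) \<in> J"
proof -
  define s where "s = (\<Sum>x\<in>V. \<Sum>y\<in>V. \<Sum>z\<in>V. fsmult (c x y z) (fletter x * fletter y * fletter z))"
  define G where "G x y z = lin6 (c x y z) (c x z y) (c y x z) (c y z x) (c z x y) (c z y x)
      (fletter x) (fletter y) (fletter z)" for x y z
  have "G x y z \<in> J" if "x \<in> V" "y \<in> V" "z \<in> V" for x y z
  proof -
    \<comment> \<open>Polarization at three substitutions supported at \<open>x\<close>,
      \<open>y\<close>, \<open>z\<close>; these letters may coincide, since each position has its
      own substitution.\<close>
    have "mlin6_identity (fst x) (fst y) (fst z) (c x y z) (c x z y) (c y x z) (c y z x) (c z x y) (c z y x)"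
      unfolding mlin6_identity_def mlin6_def
      using polarize_trilin[OF diag] M12_admissible_delta that by (metis trilin_delta[OF V])
    then show ?thesis
      unfolding G_def by (rule lin6_mem[OF _ fpoly_kind_fletter fpoly_kind_fletter fpoly_kind_fletter])
  qed
  then have "(\<Sum>x\<in>V. \<Sum>y\<in>V. \<Sum>z\<in>V. G x y z) \<in> J"
    by (intro sum_mem)
  \<comment> \<open>Each of the six orders contributes the same total after renaming the summation
    indices.\<close>
  moreover have "(\<Sum>x\<in>V. \<Sum>y\<in>V. \<Sum>z\<in>V. G x y z) = s + s + s + s + s + s"
    unfolding G_def lin6_def s_def by (subst sum_symmetrize3) (simp add: Let_def)
  moreover have "s + s + s + s + s + s = fsmult 6 s"
  proof -
    have "(6::'a) = 1 + 1 + 1 + 1 + 1 + 1"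
      by simp
    then show ?thesis
      by (simp only: fsmult_add_left fsmult_one)
  qed
  ultimately have "fsmult (1/6) (fsmult 6 s) \<in> J"
    by (metis smult_mem)
  then show ?thesis
    by (simp add: fsmult_fsmult s_def)
qed

lemma bilin_identity_mem:
  assumes V: "finite V" and diag: "\<And>\<sigma>. M12_admissible \<sigma> \<Longrightarrow> bilin V c \<sigma> \<sigma> = 0"
  shows "(\<Sum>x\<in>V. \<Sum>y\<in>V. fsmult (c x y) (fletter x * fletter y)) \<in> J"
proof -
  define s where "s = (\<Sum>x\<in>V. \<Sum>y\<in>V. fsmult (c x y) (fletter x * fletter y))"
  \<comment> \<open>With third factor 1, the first and third coefficients belong to the two orders
    of the letters.\<close>
  define G where "G x y = lin6 (c x y) 0 (c y x) 0 0 0 (fletter x) (fletter y) 1" for x y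
  have "G x y \<in> J" if "x \<in> V" "y \<in> V" for x y
  proof -
    have *: "smat (c x y) (A ** B) + smat (c y x) (B ** A) = 0"
      if "mat_kind (fst x) A" "mat_kind (fst y) B" for A B
      using polarize_bilin[OF diag] M12_admissible_delta that \<open>x \<in> V\<close> \<open>y \<in> V\<close> by (metis bilin_delta[OF V])
    have "mlin6_identity (fst x) (fst y) YP (c x y) 0 (c y x) 0 0 0"
      unfolding mlin6_identity_def mlin6_def
    proof (intro allI impI)
      fix A B C :: "'a^3^3" assume "mat_kind (fst x) A" "mat_kind (fst y) B"
      have "smat (c x y) (A ** B ** C) + smat (c y x) (B ** A ** C)
          = (smat (c x y) (A ** B) + smat (c y x) (B ** A)) ** C"
        by (simp add: smat_mult_left matrix3_add_mult)
      also have "\<dots> = 0"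
        using *[OF \<open>mat_kind (fst x) A\<close> \<open>mat_kind (fst y) B\<close>] by simp
      finally show "smat (c x y) (A ** B ** C) + smat 0 (A ** C ** B) + smat (c y x) (B ** A ** C)
          + smat 0 (B ** C ** A) + smat 0 (C ** A ** B) + smat 0 (C ** B ** A) = 0"
        by simp
    qed
    then show ?thesis
      unfolding G_def by (rule lin6_mem[OF _ fpoly_kind_fletter fpoly_kind_fletter fpoly_kind_one])
  qed
  then have "(\<Sum>x\<in>V. \<Sum>y\<in>V. G x y) \<in> J"
    by (intro sum_mem)
  moreover have "(\<Sum>x\<in>V. \<Sum>y\<in>V. G x y) = s + s"
    unfolding G_def lin6_def s_def sum.distrib
    by (simp add: sum.distrib) (rule sum.swap)
  moreover have "s + s = fsmult 2 s"
    using fsmult_add_left[of 1 1 s] by simp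
  ultimately have "fsmult (1/2) (fsmult 2 s) \<in> J"
    by (metis smult_mem)
  then show ?thesis
    by (simp add: fsmult_fsmult s_def)
qed

lemma linear_identity_mem:
  assumes V: "finite V" and ident: "\<And>\<sigma>. M12_admissible \<sigma> \<Longrightarrow> (\<Sum>x\<in>V. smat (c x) (\<sigma> x)) = 0"
  shows "(\<Sum>x\<in>V. fsmult (c x) (fletter x)) \<in> J"
proof (rule sum_mem)
  fix x assume "x \<in> V"
  have "smat (c x) A = 0" if "mat_kind (fst x) A" for A
    using ident[OF M12_admissible_delta[OF that]]
      sum_delta_subst[OF V \<open>x \<in> V\<close>, of "\<lambda>y. smat (c y)" A] by simp
  then have "mlin6_identity (fst x) YP YP (c x) 0 0 0 0 0"
    by (simp add: mlin6_identity_def mlin6_def flip: smat_mult_left)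
  from lin6_mem[OF this fpoly_kind_fletter fpoly_kind_one fpoly_kind_one]
  show "fsmult (c x) (fletter x) \<in> J"
    by (simp add: lin6_def)
qed

lemma identity_mem:
  assumes ident: "is_M12_star_identity f" and deg: "fdeg_le f 3"
  shows "f \<in> J"
proof -
  define V where "V = letters f"
  define c0 where "c0 = Poly_Mapping.lookup f (W [])"
  define c1 where "c1 x = Poly_Mapping.lookup f (W [x])" for x
  define c2 where "c2 x y = Poly_Mapping.lookup f (W [x, y])" for x y
  define c3 where "c3 x y z = Poly_Mapping.lookup f (W [x, y, z])" for x y z
  have V: "finite V"
    by (simp add: V_def finite_letters)
  have "f = (\<Sum>w\<in>Poly_Mapping.keys f. Poly_Mapping.single w (Poly_Mapping.lookup f w))"
    by (simp add: sum_single_keys)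
  also have "\<dots> = Poly_Mapping.single (W []) c0 + (\<Sum>x\<in>V. Poly_Mapping.single (W [x]) (c1 x))
      + (\<Sum>x\<in>V. \<Sum>y\<in>V. Poly_Mapping.single (W [x, y]) (c2 x y))
      + (\<Sum>x\<in>V. \<Sum>y\<in>V. \<Sum>z\<in>V. Poly_Mapping.single (W [x, y, z]) (c3 x y z))"
    unfolding c0_def c1_def c2_def c3_def
    by (rule sum_keys_fdeg_le_3[OF deg V_def]) (simp add: in_keys_iff)
  also have "\<dots> = fsmult c0 1 + (\<Sum>x\<in>V. fsmult (c1 x) (fletter x))
      + (\<Sum>x\<in>V. \<Sum>y\<in>V. fsmult (c2 x y) (fletter x * fletter y))
      + (\<Sum>x\<in>V. \<Sum>y\<in>V. \<Sum>z\<in>V. fsmult (c3 x y z) (fletter x * fletter y * fletter z))"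
    by (simp add: fletter_def fvar_def mult_single fsmult_def zero_word_def flip: single_one)
  finally have f_eq: "f = \<dots>" .
  have eval: "eval_fpoly \<sigma> f = smat c0 (mat 1) + (\<Sum>x\<in>V. smat (c1 x) (\<sigma> x))
      + bilin V c2 \<sigma> \<sigma> + trilin V c3 \<sigma> \<sigma> \<sigma>" for \<sigma>
  proof -
    have "eval_fpoly \<sigma> f = (\<Sum>w\<in>Poly_Mapping.keys f. smat (Poly_Mapping.lookup f w) (eval_word \<sigma> w))"
      by (simp add: eval_fpoly_def smat_def)
    also have "\<dots> = smat c0 (eval_word \<sigma> (W [])) + (\<Sum>x\<in>V. smat (c1 x) (eval_word \<sigma> (W [x])))
      + (\<Sum>x\<in>V. \<Sum>y\<in>V. smat (c2 x y) (eval_word \<sigma> (W [x, y])))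
      + (\<Sum>x\<in>V. \<Sum>y\<in>V. \<Sum>z\<in>V. smat (c3 x y z) (eval_word \<sigma> (W [x, y, z])))"
      unfolding c0_def c1_def c2_def c3_def
      by (rule sum_keys_fdeg_le_3[OF deg V_def]) (simp add: in_keys_iff)
    finally show ?thesis
      by (simp add: eval_word_def bilin_def trilin_def matrix_mul_assoc)
  qed
  have homogeneous: "smat c0 (mat 1) = 0 \<and> (\<Sum>x\<in>V. smat (c1 x) (\<sigma> x)) = 0 \<and>
      bilin V c2 \<sigma> \<sigma> = 0 \<and> trilin V c3 \<sigma> \<sigma> \<sigma> = 0" if adm: "M12_admissible \<sigma>" for \<sigma>
  proof -
    define E0 where "E0 = smat c0 (mat 1)"
    define E1 where "E1 = (\<Sum>x\<in>V. smat (c1 x) (\<sigma> x))"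
    define E2 where "E2 = bilin V c2 \<sigma> \<sigma>"
    define E3 where "E3 = trilin V c3 \<sigma> \<sigma> \<sigma>"
    have entry: "E0 $ i $ j + t * E1 $ i $ j + t * t * E2 $ i $ j + t * t * t * E3 $ i $ j = 0" for t i j
    proof -
      \<comment> \<open>Scaling preserves the kinds and multiplies the component of degree
        \<open>d\<close> by the \<open>d\<close>-th power of \<open>t\<close>.\<close>
      have "M12_admissible (\<lambda>x. smat t (\<sigma> x))"
        using adm by (simp add: M12_admissible_iff mat_kind_smat)
      with ident have "0 = eval_fpoly (\<lambda>x. smat t (\<sigma> x)) f"
        by (simp add: is_M12_star_identity_def)
      also have "\<dots> = E0 + smat t E1 + smat (t * t) E2 + smat (t * t * t) E3"
        unfolding eval E0_def E1_def E2_def E3_def bilin_def trilin_def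
        by (simp add: smat_sum_right smat_smat smat_mult_left smat_mult_right mult_ac)
      finally have "0 = (E0 + smat t E1 + smat (t * t) E2 + smat (t * t * t) E3) $ i $ j"
        by simp
      then show ?thesis
        by simp
    qed
    from cubic_vanishing[OF this] have "E0 = 0" "E1 = 0" "E2 = 0" "E3 = 0"
      by (simp_all add: vec_eq_iff)
    then show ?thesis
      by (simp add: E0_def E1_def E2_def E3_def)
  qed
  \<comment> \<open>Some admissible substitution must exist before the constant term can be
    concluded to vanish.\<close>
  have "M12_admissible (\<lambda>_. 0 :: 'a^3^3)"
    by (simp add: M12_admissible_iff mat_kind_zero)
  then have "smat c0 (mat 1) = 0"
    using homogeneous by blast
  then have "c0 = 0"
    by (simp add: matrix3_eq_iff mat_def)
  moreover have "(\<Sum>x\<in>V. fsmult (c1 x) (fletter x)) \<in> J"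
    using homogeneous by (intro linear_identity_mem[OF V]) blast
  moreover have "(\<Sum>x\<in>V. \<Sum>y\<in>V. fsmult (c2 x y) (fletter x * fletter y)) \<in> J"
    using homogeneous by (intro bilin_identity_mem[OF V]) blast
  moreover have "(\<Sum>x\<in>V. \<Sum>y\<in>V. \<Sum>z\<in>V. fsmult (c3 x y z) (fletter x * fletter y * fletter z)) \<in> J"
    using homogeneous by (intro trilin_identity_mem[OF V]) blast
  ultimately show ?thesis
    by (subst f_eq) (simp add: add_mem)
qed

end

theorem theorem4p8:
  fixes f :: "'a::field_char_0 fpoly"
  assumes "is_M12_star_identity f"
    and "fdeg_le f 3"
  shows "f \<in> T2star_ideal_gen gens_I"
  unfolding T2star_ideal_gen_def
  using M12_T2star_ideal.identity_mem[OF M12_T2star_ideal.intro] assms by blast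

end
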